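(* Let $p$ be a prime and let $K$ and $L$ be $\mathbb{Z}_p$-complexes such that $I_p(K)=I(K)-1$ and $I_p(L)=I(L)-1$. Then $I(K*L)\leq I(K)+I(L)-1$. Moreover, the Smith class $A^{I(K)+I(L)-2}(K*L)$ is zero modulo $p$.
   Context: All simplicial complexes are finite. A $\mathbb{Z}_p$-complex is a simplicial complex $K$ with a simplicial automorphism $t$, $t^p=\mathrm{id}$, such that $t^k\sigma\neq\sigma$ for every non-empty simplex $\sigma$ and every $k\not\equiv0 \pmod p$. The join $K*L$ is a $\mathbb{Z}_p$-complex via the action of $t$ on the vertices of each factor. $C_*(K)$, $C^*(K)$ are the integral simplicial chain and cochain complexes (dimensions $\geq 0$); $t$ also denotes the induced maps; $d=1-t$, $s=1+t+\cdots+t^{p-1}$. Let $C^i_d(K)=\ker(d)=\mathrm{im}(s)\subset C^i(K)$ and $C^i_s(K)=\ker(s)=\mathrm{im}(d)\subset C^i(K)$; these are subcomplexes with cohomologies $H^i_d(K)$, $H^i_s(K)$. A resolution of $1$ is a sequence $\phi_j\in C^j(K)$, $j\ge 0$, with $s\phi_0=1$ (the cochain with value $1$ on each vertex), $\delta\phi_j=d\phi_{j+1}$ for $j$ even, $\delta\phi_j=s\phi_{j+1}$ for $j$ odd. The $j$-th Smith class $A^j(K)$ is $[s\phi_j]\in H^j_d(K)$ if $j$ is even and $[d\phi_j]\in H^j_s(K)$ if $j$ is odd; it is independent of the resolution. Its reduction modulo $n$ is its image under coefficient reduction $\mathbb{Z}\to\mathbb{Z}/n$ (in the cohomology of $C^*_d(K)\otimes\mathbb{Z}/n$,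 resp. $C^*_s(K)\otimes\mathbb{Z}/n$). The Smith index $I(K)$ is the smallest $n\geq0$ with $A^n(K)=0$; $I_p(K)$ is the smallest $n\ge0$ such that the reduction of $A^n(K)$ modulo $p$ is zero. *)

theory Defs
  imports "HOL-Algebra.Coset" "HOL-Combinatorics.Permutations"
    "HOL-Library.Function_Algebras" "HOL-Computational_Algebra.Primes"
begin

section \<open>Cohomology of cochain complexes of abelian groups\<close>

text \<open>
  A cochain complex is given by its groups \<open>G i\<close> and differentials \<open>\<delta> i\<close> from \<open>G i\<close> to
  \<open>G (i + 1)\<close>, for \<open>i \<ge> 0\<close>. The groups are abelian, although HOL-Algebra writes them
  multiplicatively; a cohomology class is a coset of the group of coboundaries.
\<close>

definition cocycles :: "(nat \<Rightarrow> 'c monoid) \<Rightarrow> (nat \<Rightarrow> 'c \<Rightarrow> 'c) \<Rightarrow> nat \<Rightarrow> 'c set" where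
  "cocycles G \<delta> i = {x \<in> carrier (G i). \<delta> i x = \<one>\<^bsub>G (Suc i)\<^esub>}"

definition coboundaries :: "(nat \<Rightarrow> 'c monoid) \<Rightarrow> (nat \<Rightarrow> 'c \<Rightarrow> 'c) \<Rightarrow> nat \<Rightarrow> 'c set" where
  "coboundaries G \<delta> i = (case i of 0 \<Rightarrow> {\<one>\<^bsub>G 0\<^esub>} | Suc j \<Rightarrow> \<delta> j ` carrier (G j))"

definition cohomology :: "(nat \<Rightarrow> 'c monoid) \<Rightarrow> (nat \<Rightarrow> 'c \<Rightarrow> 'c) \<Rightarrow> nat \<Rightarrow> 'c set monoid" where
  "cohomology G \<delta> i = (G i)\<lparr>carrier := cocycles G \<delta> i\<rparr> Mod coboundaries G \<delta> i"

definition cohomology_class :: "(nat \<Rightarrow> 'c monoid) \<Rightarrow> (nat \<Rightarrow> 'c \<Rightarrow> 'c) \<Rightarrow> nat \<Rightarrow> 'c \<Rightarrow> 'c set" where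
  "cohomology_class G \<delta> i z = coboundaries G \<delta> i #>\<^bsub>G i\<^esub> z"

text \<open>
  The complex \<open>G \<otimes> \<int>/n\<close> is realised as \<open>G/nG\<close>. If \<open>f\<close> is a homomorphism into \<open>H\<close> that descends
  to a map of quotients \<open>G/A \<rightarrow> H/B\<close>, then the descended map sends a coset \<open>X\<close> of \<open>A\<close> to the
  coset \<open>B <#> f ` X\<close> of \<open>B\<close>; the induced differential and the induced map on cohomology are
  both written in this way.
\<close>

definition multiples :: "nat \<Rightarrow> 'c monoid \<Rightarrow> 'c set" where
  "multiples n G = (\<lambda>x. x [^]\<^bsub>G\<^esub> n) ` carrier G"

definition mod_groups :: "nat \<Rightarrow> (nat \<Rightarrow> 'c monoid) \<Rightarrow> nat \<Rightarrow> 'c set monoid" where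
  "mod_groups n G i = G i Mod multiples n (G i)"

definition mod_diff ::
  "nat \<Rightarrow> (nat \<Rightarrow> 'c monoid) \<Rightarrow> (nat \<Rightarrow> 'c \<Rightarrow> 'c) \<Rightarrow> nat \<Rightarrow> 'c set \<Rightarrow> 'c set" where
  "mod_diff n G \<delta> i X = multiples n (G (Suc i)) <#>\<^bsub>G (Suc i)\<^esub> (\<delta> i ` X)"

definition reduction ::
  "nat \<Rightarrow> (nat \<Rightarrow> 'c monoid) \<Rightarrow> (nat \<Rightarrow> 'c \<Rightarrow> 'c) \<Rightarrow> nat \<Rightarrow> 'c set \<Rightarrow> 'c set set" where
  "reduction n G \<delta> i \<alpha> =
     coboundaries (mod_groups n G) (mod_diff n G \<delta>) i <#>\<^bsub>mod_groups n G i\<^esub>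
       ((\<lambda>z. multiples n (G i) #>\<^bsub>G i\<^esub> z) ` \<alpha>)"


section \<open>Simplicial complexes with a free action of a cyclic group\<close>

text \<open>Complexes contain the empty simplex; the complex without vertices is \<open>{{}}\<close>.\<close>

definition simplicial_complex :: "'a set set \<Rightarrow> bool" where
  "simplicial_complex K \<longleftrightarrow> finite K \<and> {} \<in> K \<and>
     (\<forall>\<sigma>\<in>K. finite \<sigma>) \<and> (\<forall>\<sigma>\<in>K. \<forall>\<tau>. \<tau> \<subseteq> \<sigma> \<longrightarrow> \<tau> \<in> K)"

definition simplicial_automorphism :: "'a set set \<Rightarrow> ('a \<Rightarrow> 'a) \<Rightarrow> bool" where
  "simplicial_automorphism K t \<longleftrightarrow>
     bij_betw t (\<Union>K) (\<Union>K) \<and> (\<forall>\<sigma>. \<sigma> \<subseteq> \<Union>K \<longrightarrow> (t ` \<sigma> \<in> K \<longleftrightarrow> \<sigma> \<in> K))"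

text \<open>The values of \<open>t\<close> outside the vertex set \<open>\<Union>K\<close> are irrelevant.\<close>

definition Zp_complex :: "nat \<Rightarrow> 'a set set \<Rightarrow> ('a \<Rightarrow> 'a) \<Rightarrow> bool" where
  "Zp_complex p K t \<longleftrightarrow> simplicial_complex K \<and> simplicial_automorphism K t \<and>
     (\<forall>v\<in>\<Union>K. (t ^^ p) v = v) \<and>
     (\<forall>\<sigma>\<in>K. \<sigma> \<noteq> {} \<longrightarrow> (\<forall>k. \<not> p dvd k \<longrightarrow> (t ^^ k) ` \<sigma> \<noteq> \<sigma>))"

text \<open>The generator acts on the vertices of the join by \<open>map_sum t u\<close>.\<close>

definition simplicial_join :: "'a set set \<Rightarrow> 'b set set \<Rightarrow> ('a + 'b) set set" where
  "simplicial_join K L = {\<sigma> <+> \<tau> |\<sigma> \<tau>. \<sigma> \<in> K \<and> \<tau> \<in> L}"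


section \<open>Simplicial cochains\<close>

text \<open>
  The chain group \<open>C\<^sub>i(K)\<close> is generated by the ordered \<open>i\<close>-simplices, where permuting the vertices
  multiplies a generator by the sign of the permutation. Integral cochains, being homomorphisms
  \<open>C\<^sub>i(K) \<rightarrow> \<int>\<close>, are thus the alternating functions on ordered \<open>i\<close>-simplices; they are extended
  by 0 to all lists.
\<close>

definition ordered_simplices :: "'a set set \<Rightarrow> nat \<Rightarrow> 'a list set" where
  "ordered_simplices K i = {xs. length xs = Suc i \<and> distinct xs \<and> set xs \<in> K}"

definition cochains :: "'a set set \<Rightarrow> nat \<Rightarrow> ('a list \<Rightarrow> int) set" where
  "cochains K i = {f. (\<forall>xs. xs \<notin> ordered_simplices K i \<longrightarrow> f xs = 0) \<and>
     (\<forall>xs\<in>ordered_simplices K i. \<forall>\<pi>. \<pi> permutes {..<Suc i} \<longrightarrow>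
        f (permute_list \<pi> xs) = sign \<pi> * f xs)}"

definition coboundary :: "'a set set \<Rightarrow> ('a list \<Rightarrow> int) \<Rightarrow> 'a list \<Rightarrow> int" where
  "coboundary K f xs = (if distinct xs \<and> set xs \<in> K
     then \<Sum>j<length xs. (- 1) ^ j * f (take j xs @ drop (Suc j) xs) else 0)"

definition unit_cochain :: "'a set set \<Rightarrow> 'a list \<Rightarrow> int" where
  "unit_cochain K xs = (if xs \<in> ordered_simplices K 0 then 1 else 0)"

text \<open>
  The map induced on cochains is precomposition with \<open>t\<close>. The guard removes spurious values
  on lists with entries outside \<open>\<Union>K\<close>, which \<open>t\<close> may send to vertices of \<open>K\<close>.
\<close>

definition t_op :: "'a set set \<Rightarrow> ('a \<Rightarrow> 'a) \<Rightarrow> ('a list \<Rightarrow> int) \<Rightarrow> 'a list \<Rightarrow> int" where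
  "t_op K t f xs = (if set xs \<in> K then f (map t xs) else 0)"

definition d_op :: "'a set set \<Rightarrow> ('a \<Rightarrow> 'a) \<Rightarrow> ('a list \<Rightarrow> int) \<Rightarrow> 'a list \<Rightarrow> int" where
  "d_op K t f = f - t_op K t f"

definition s_op :: "nat \<Rightarrow> 'a set set \<Rightarrow> ('a \<Rightarrow> 'a) \<Rightarrow> ('a list \<Rightarrow> int) \<Rightarrow> 'a list \<Rightarrow> int" where
  "s_op p K t f = (\<Sum>k<p. (t_op K t ^^ k) f)"

definition additive_group :: "'c::ab_group_add set \<Rightarrow> 'c monoid" where
  "additive_group A = \<lparr>carrier = A, monoid.mult = (+), one = 0\<rparr>"

definition C_d :: "'a set set \<Rightarrow> ('a \<Rightarrow> 'a) \<Rightarrow> nat \<Rightarrow> ('a list \<Rightarrow> int) monoid" where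
  "C_d K t i = additive_group {f \<in> cochains K i. d_op K t f = 0}"

definition C_s :: "nat \<Rightarrow> 'a set set \<Rightarrow> ('a \<Rightarrow> 'a) \<Rightarrow> nat \<Rightarrow> ('a list \<Rightarrow> int) monoid" where
  "C_s p K t i = additive_group {f \<in> cochains K i. s_op p K t f = 0}"


section \<open>Smith classes and Smith indices\<close>

definition resolution ::
  "nat \<Rightarrow> 'a set set \<Rightarrow> ('a \<Rightarrow> 'a) \<Rightarrow> (nat \<Rightarrow> 'a list \<Rightarrow> int) \<Rightarrow> bool" where
  "resolution p K t \<phi> \<longleftrightarrow> (\<forall>j. \<phi> j \<in> cochains K j) \<and>
     s_op p K t (\<phi> 0) = unit_cochain K \<and>
     (\<forall>j. even j \<longrightarrow> coboundary K (\<phi> j) = d_op K t (\<phi> (Suc j))) \<and>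
     (\<forall>j. odd j \<longrightarrow> coboundary K (\<phi> j) = s_op p K t (\<phi> (Suc j)))"

text \<open>The subcomplex of cochains in whose cohomology the \<open>j\<close>-th Smith class lives.\<close>

definition smith_complex ::
  "nat \<Rightarrow> 'a set set \<Rightarrow> ('a \<Rightarrow> 'a) \<Rightarrow> nat \<Rightarrow> nat \<Rightarrow> ('a list \<Rightarrow> int) monoid" where
  "smith_complex p K t j = (if even j then C_d K t else C_s p K t)"

text \<open>
  Every \<open>\<int>\<^sub>p\<close>-complex has a resolution and the Smith classes do not depend on it, so an arbitrary
  one is chosen.
\<close>

definition smith_class ::
  "nat \<Rightarrow> 'a set set \<Rightarrow> ('a \<Rightarrow> 'a) \<Rightarrow> nat \<Rightarrow> ('a list \<Rightarrow> int) set" where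
  "smith_class p K t j = (let \<phi> = (SOME \<phi>. resolution p K t \<phi>) in
     cohomology_class (smith_complex p K t j) (\<lambda>_. coboundary K) j
       (if even j then s_op p K t (\<phi> j) else d_op K t (\<phi> j)))"

definition smith_class_zero :: "nat \<Rightarrow> 'a set set \<Rightarrow> ('a \<Rightarrow> 'a) \<Rightarrow> nat \<Rightarrow> bool" where
  "smith_class_zero p K t j \<longleftrightarrow>
     smith_class p K t j = \<one>\<^bsub>cohomology (smith_complex p K t j) (\<lambda>_. coboundary K) j\<^esub>"

definition smith_class_zero_mod :: "nat \<Rightarrow> nat \<Rightarrow> 'a set set \<Rightarrow> ('a \<Rightarrow> 'a) \<Rightarrow> nat \<Rightarrow> bool" where
  "smith_class_zero_mod n p K t j \<longleftrightarrow>
     (let G = smith_complex p K t j; \<delta> = (\<lambda>_. coboundary K) in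
      reduction n G \<delta> j (smith_class p K t j) =
        \<one>\<^bsub>cohomology (mod_groups n G) (mod_diff n G \<delta>) j\<^esub>)"

definition smith_index :: "nat \<Rightarrow> 'a set set \<Rightarrow> ('a \<Rightarrow> 'a) \<Rightarrow> nat" where
  "smith_index p K t = (LEAST n. smith_class_zero p K t n)"

definition smith_index_mod :: "nat \<Rightarrow> 'a set set \<Rightarrow> ('a \<Rightarrow> 'a) \<Rightarrow> nat" where
  "smith_index_mod p K t = (LEAST n. smith_class_zero_mod p p K t n)"

end

theory Submission
  imports Defs "HOL.Modules"
begin

text \<open>
  A resolution of 1 is an equivariant chain map from the simplicial chains to the standard resolution
  of the cyclic group, and changing it within its class shows that the Smith class \<open>A\<^sup>m(K)\<close> is zero
  modulo \<open>p\<close> if and only if some resolution has all its terms of index at least \<open>m\<close> divisible by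
  \<open>p\<close>. Two resolutions \<open>\<phi>\<close> of \<open>K\<close> and \<open>\<psi>\<close> of \<open>L\<close> have a product, a resolution of the
  join whose term of index \<open>k\<close> is a combination of products of translates of \<open>\<phi>\<^sub>i\<close> and \<open>\<psi>\<^sub>j\<close> with
  \<open>i + j + 1 = k\<close>, where \<open>\<phi>\<close> and \<open>\<psi>\<close> of index \<open>- 1\<close> are the augmentations. If \<open>A\<^sup>m(K)\<close> and
  \<open>A\<^sup>n(L)\<close> are zero modulo \<open>p\<close>, then every term of index \<open>m + n\<close> contains a factor divisible by
  \<open>p\<close>, so \<open>A\<^sup>m\<^sup>+\<^sup>n\<close> of the join is zero modulo \<open>p\<close>. Finally, a Smith class that is zero modulo
  \<open>p\<close> is followed by a Smith class that is zero integrally.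
\<close>


section \<open>Alternating cochains\<close>

lemma additive_of_nat_times:
  fixes f :: "'a::ring_1 \<Rightarrow> 'b::ring_1"
  assumes "additive f"
  shows "f (of_nat n * x) = of_nat n * f x"
  by (induction n) (simp_all add: additive.zero[OF assms] additive.add[OF assms] distrib_right)

lemmas pointwise =
  plus_fun_apply zero_fun_apply times_fun_apply of_nat_fun_apply minus_apply uminus_apply

lemma sum_fun_apply: "(\<Sum>i\<in>A. f i) x = (\<Sum>i\<in>A. f i x)"
  by (induction A rule: infinite_finite_induct) simp_all

(* Otherwise the simplifier unfolds eta-expanded sums of cochains pointwise. *)
declare pointwise [simp del]

text \<open>Only adjacent entries are exchanged, which makes the property easy to verify by
  induction on lists; arbitrary permutations follow in
  \<open>alternating_permute_list\<close>.\<close>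

definition alternating :: "('a list \<Rightarrow> int) \<Rightarrow> bool" where
  "alternating f \<longleftrightarrow> (\<forall>as x y bs. f (as @ x # y # bs) = - f (as @ y # x # bs))"

lemma alternatingD: "alternating f \<Longrightarrow> f (as @ x # y # bs) = - f (as @ y # x # bs)"
  unfolding alternating_def by blast

text \<open>Move \<open>x\<close> past \<open>m\<close>, exchange across the shorter block, then
  move \<open>y\<close> in front of \<open>m\<close>: three sign changes, hence one.\<close>

lemma alternating_exchange:
  assumes "alternating f"
  shows "f (as @ x # ms @ y # bs) = - f (as @ y # ms @ x # bs)"
proof (induction ms arbitrary: as)
  case Nil
  show ?case using alternatingD[OF assms, of as x y bs] by simp
next
  case (Cons m ms)
  have "f (as @ x # (m # ms) @ y # bs) = - f ((as @ [m]) @ x # ms @ y # bs)"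
    using alternatingD[OF assms, of as x m] by simp
  also have "\<dots> = f (as @ m # y # ms @ x # bs)"
    using Cons.IH[of "as @ [m]"] by simp
  also have "\<dots> = - f (as @ y # (m # ms) @ x # bs)"
    using alternatingD[OF assms, of as m y] by simp
  finally show ?case .
qed

lemma permute_list_transpose:
  assumes "length as = i" "length ms = k"
  shows "permute_list (transpose i (Suc (i + k))) (as @ x # ms @ y # bs) = as @ y # ms @ x # bs"
proof (rule nth_equalityI)
  fix j
  assume "j < length (permute_list (transpose i (Suc (i + k))) (as @ x # ms @ y # bs))"
  then have j: "j < length (as @ x # ms @ y # bs)"
    by simp
  have "transpose i (Suc (i + k)) permutes {..<length (as @ x # ms @ y # bs)}"
    using assms by (intro permutes_swap_id) auto
  then have "permute_list (transpose i (Suc (i + k))) (as @ x # ms @ y # bs) ! j =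
      (as @ x # ms @ y # bs) ! transpose i (Suc (i + k)) j"
    using j by (rule permute_list_nth)
  also have "\<dots> = (as @ y # ms @ x # bs) ! j"
    using assms by (auto simp: transpose_def nth_append nth_Cons' not_less)
  finally show "permute_list (transpose i (Suc (i + k))) (as @ x # ms @ y # bs) ! j =
    (as @ y # ms @ x # bs) ! j" .
qed simp

lemma alternating_transpose:
  assumes f: "alternating f" and "i < j" "j < length xs"
  shows "f (permute_list (transpose i j) xs) = - f xs"
proof -
  define as where "as = take i xs"
  define ms where "ms = take (j - Suc i) (drop (Suc i) xs)"
  define bs where "bs = drop (Suc j) xs"
  have xs: "xs = as @ xs ! i # ms @ xs ! j # bs"
  proof -
    have "xs = as @ xs ! i # drop (Suc i) xs"
      using assms by (simp add: as_def id_take_nth_drop)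
    also have "drop (Suc i) xs = ms @ drop (j - Suc i) (drop (Suc i) xs)"
      unfolding ms_def by (rule append_take_drop_id[symmetric])
    also have "drop (j - Suc i) (drop (Suc i) xs) = xs ! j # bs"
      using assms by (simp add: bs_def Cons_nth_drop_Suc)
    finally show ?thesis .
  qed
  have len: "length as = i" "length ms = j - Suc i"
    using assms by (auto simp: as_def ms_def)
  have "j = Suc (i + (j - Suc i))" using assms by simp
  then have "permute_list (transpose i j) xs = as @ xs ! j # ms @ xs ! i # bs"
    using permute_list_transpose[OF len] xs by metis
  then show ?thesis
    using alternating_exchange[OF f, of as "xs ! i" ms "xs ! j" bs] xs by simp
qed

text \<open>A permutation of the positions is a product of transpositions, and each of them
  contributes one sign.\<close>

lemma alternating_permute_list:
  assumes f: "alternating f" and "\<pi> permutes {..<length xs}"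
  shows "f (permute_list \<pi> xs) = sign \<pi> * f xs"
  using finite_lessThan assms(2)
proof (induction \<pi> rule: permutes_rev_induct)
  case id
  show ?case by (simp add: sign_id)
next
  case (swap a b \<pi>)
  have tr: "transpose a b permutes {..<length xs}"
    using swap by (intro permutes_swap_id) auto
  have "f (permute_list (\<pi> \<circ> transpose a b) xs) = f (permute_list (transpose a b) (permute_list \<pi> xs))"
    using permute_list_compose[OF tr] by simp
  also have "\<dots> = - f (permute_list \<pi> xs)"
    using swap alternating_transpose[OF f, of a b "permute_list \<pi> xs"]
      alternating_transpose[OF f, of b a "permute_list \<pi> xs"]
    by (cases "a < b") (auto simp: transpose_commute)
  also have "\<dots> = sign (\<pi> \<circ> transpose a b) * f xs"
    using swap tr by (simp add: sign_compose sign_swap_id permutes_imp_permutation[OF finite_lessThan] permutation_swap_id)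
  finally show ?case .
qed

section \<open>Cochains graded by the number of vertices\<close>

text \<open>
  Degrees are shifted: \<open>m\<close> is the number of vertices, so the augmentation sits in degree 0
  and the join becomes a tensor product without shift.
\<close>

definition aug_cochains :: "'a set set \<Rightarrow> nat \<Rightarrow> ('a list \<Rightarrow> int) set" where
  "aug_cochains K m =
     {f. alternating f \<and> (\<forall>xs. f xs \<noteq> 0 \<longrightarrow> length xs = m \<and> distinct xs \<and> set xs \<in> K)}"

text \<open>From left to right, an adjacent swap is a transposition of sign -1; the converse is
  \<open>alternating_permute_list\<close>. The degree rises by one because an
  \<open>i\<close>-simplex has \<open>i + 1\<close> vertices.\<close>

lemma cochains_eq: "cochains K i = aug_cochains K (Suc i)"
proof (intro equalityI subsetI)
  fix f assume f: "f \<in> cochains K i"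
  have supp: "xs \<in> ordered_simplices K i" if "f xs \<noteq> 0" for xs
    using f that by (auto simp: cochains_def)
  have "f (as @ x # y # bs) = - f (as @ y # x # bs)" for as x y bs
  proof (cases "as @ x # y # bs \<in> ordered_simplices K i")
    case True
    then have perm: "transpose (length as) (Suc (length as)) permutes {..<Suc i}"
      by (intro permutes_swap_id) (auto simp: ordered_simplices_def)
    have "f (permute_list (transpose (length as) (Suc (length as))) (as @ x # y # bs)) =
        - f (as @ x # y # bs)"
      using f True perm by (simp add: cochains_def sign_swap_id)
    then show ?thesis
      using permute_list_transpose[of as "length as" "[]" 0 x y bs] by simp
  next
    case False
    then have "as @ y # x # bs \<notin> ordered_simplices K i"
      by (auto simp: ordered_simplices_def insert_commute)
    then have "f (as @ y # x # bs) = 0" "f (as @ x # y # bs) = 0"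
      using False supp by blast+
    then show ?thesis by simp
  qed
  then show "f \<in> aug_cochains K (Suc i)"
    using supp unfolding aug_cochains_def alternating_def ordered_simplices_def by blast
next
  fix f assume "f \<in> aug_cochains K (Suc i)"
  then show "f \<in> cochains K i"
    using alternating_permute_list[of f]
    by (fastforce simp: aug_cochains_def cochains_def ordered_simplices_def)
qed

lemma aug_cochains_alternating: "f \<in> aug_cochains K m \<Longrightarrow> alternating f"
  and aug_cochains_support:
    "f \<in> aug_cochains K m \<Longrightarrow> f xs \<noteq> 0 \<Longrightarrow> length xs = m \<and> distinct xs \<and> set xs \<in> K"
  by (auto simp: aug_cochains_def)

lemma aug_cochains_zero: "0 \<in> aug_cochains K m"
  by (simp add: aug_cochains_def alternating_def pointwise)

lemma aug_cochains_diff: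
  assumes "f \<in> aug_cochains K m" "g \<in> aug_cochains K m"
  shows "f - g \<in> aug_cochains K m"
proof -
  have "(f - g) (as @ x # y # bs) = - (f - g) (as @ y # x # bs)" for as x y bs
    using alternatingD[OF aug_cochains_alternating[OF assms(1)], of as x y bs]
      alternatingD[OF aug_cochains_alternating[OF assms(2)], of as x y bs]
    by (simp add: pointwise)
  then have "alternating (f - g)"
    unfolding alternating_def by blast
  then show ?thesis
    using aug_cochains_support[OF assms(1)] aug_cochains_support[OF assms(2)]
    by (auto simp: aug_cochains_def pointwise) (metis diff_0_right)+
qed

lemma aug_cochains_uminus: "f \<in> aug_cochains K m \<Longrightarrow> - f \<in> aug_cochains K m"
  using aug_cochains_diff[OF aug_cochains_zero, of f] by simp

lemma aug_cochains_add:
  "f \<in> aug_cochains K m \<Longrightarrow> g \<in> aug_cochains K m \<Longrightarrow> f + g \<in> aug_cochains K m"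
  using aug_cochains_diff[of f K m "- g"] aug_cochains_uminus[of g] by simp

lemma aug_cochains_sum:
  "(\<And>i. i \<in> A \<Longrightarrow> f i \<in> aug_cochains K m) \<Longrightarrow> (\<Sum>i\<in>A. f i) \<in> aug_cochains K m"
  by (induction A rule: infinite_finite_induct) (auto intro: aug_cochains_zero aug_cochains_add)

lemma aug_cochains_scale: "f \<in> aug_cochains K m \<Longrightarrow> of_nat n * f \<in> aug_cochains K m"
  by (induction n) (auto intro: aug_cochains_zero aug_cochains_add simp: distrib_right)

lemma aug_cochains_divide:
  assumes "f \<in> aug_cochains K m" "\<And>xs. int n dvd f xs"
  shows "\<exists>g\<in>aug_cochains K m. f = of_nat n * g"
proof (intro bexI[of _ "\<lambda>xs. f xs div int n"])
  \<comment> \<open>Exactness of the division matters: rounding does not commute with the change of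
    sign.\<close>
  have "alternating (\<lambda>xs. f xs div int n)"
    using alternatingD[OF aug_cochains_alternating[OF assms(1)]] assms(2)
    unfolding alternating_def by (metis dvd_neg_div)
  then show "(\<lambda>xs. f xs div int n) \<in> aug_cochains K m"
    using aug_cochains_support[OF assms(1)] by (force simp: aug_cochains_def)
qed (use assms in \<open>auto simp: fun_eq_iff pointwise\<close>)

section \<open>Faces and coboundaries\<close>

text \<open>
  The recursive form of the alternating sum over faces lets identities be proved by induction on
  lists, without signs of the form \<open>(-1)^j\<close>.
\<close>

fun face_sum :: "('a list \<Rightarrow> int) \<Rightarrow> 'a list \<Rightarrow> int" where
  "face_sum f [] = 0" |
  "face_sum f (x # xs) = f xs - face_sum (\<lambda>ys. f (x # ys)) xs"

lemma face_sum_eq: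
  "(\<Sum>j<length xs. (- 1) ^ j * f (take j xs @ drop (Suc j) xs)) = face_sum f xs"
  by (induction xs arbitrary: f) (simp_all add: sum.lessThan_Suc_shift sum_negf del: sum.lessThan_Suc)

lemma coboundary_eq:
  "coboundary K f xs = (if distinct xs \<and> set xs \<in> K then face_sum f xs else 0)"
  by (simp add: coboundary_def face_sum_eq)

text \<open>When \<open>xs\<close> is a simplex, guards such as the one in \<open>t_op\<close> hold
  on all its faces, and this rule removes them.\<close>

lemma face_sum_cong:
  assumes "\<And>ys. set ys \<subseteq> set xs \<Longrightarrow> length xs = Suc (length ys) \<Longrightarrow>
    (distinct xs \<Longrightarrow> distinct ys) \<Longrightarrow> f ys = g ys"
  shows "face_sum f xs = face_sum g xs"
  using assms
proof (induction xs arbitrary: f g)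
  case (Cons x xs)
  have "face_sum (\<lambda>ys. f (x # ys)) xs = face_sum (\<lambda>ys. g (x # ys)) xs"
    by (rule Cons.IH, rule Cons.prems) auto
  moreover have "f xs = g xs" by (rule Cons.prems) auto
  ultimately show ?case by simp
qed simp

lemma face_sum_zero [simp]: "face_sum (\<lambda>_. 0) xs = 0"
  by (induction xs) auto

lemma face_sum_add: "face_sum (\<lambda>xs. f xs + g xs) xs = face_sum f xs + face_sum g xs"
  by (induction xs arbitrary: f g) auto

lemma face_sum_diff: "face_sum (\<lambda>xs. f xs - g xs) xs = face_sum f xs - face_sum g xs"
  by (induction xs arbitrary: f g) auto

lemma face_sum_scale: "face_sum (\<lambda>xs. c * f xs) xs = c * face_sum f xs"
  by (induction xs arbitrary: f) (auto simp: algebra_simps)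

lemma face_sum_uminus: "face_sum (\<lambda>xs. - f xs) xs = - face_sum f xs"
  using face_sum_scale[of "- 1"] by simp

lemma face_sum_map: "face_sum f (map h xs) = face_sum (\<lambda>ys. f (map h ys)) xs"
  by (induction xs arbitrary: f) auto

text \<open>Deleting the head first cancels against deleting it second; what remains is the
  induction hypothesis for \<open>f\<close> with the head put in front.\<close>

lemma face_sum_face_sum: "face_sum (face_sum f) xs = 0"
  by (induction xs arbitrary: f) (auto simp: face_sum_diff)

lemma alternating_Cons: "alternating f \<Longrightarrow> alternating (\<lambda>ys. f (x # ys))"
  unfolding alternating_def by (metis append_Cons)

lemma alternating_face_sum:
  assumes "alternating f"
  shows "alternating (face_sum f)"
proof -
  have "face_sum f (as @ x # y # bs) = - face_sum f (as @ y # x # bs)" for as x y bs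
    using assms
  proof (induction as arbitrary: f)
    case Nil
    \<comment> \<open>Deleting one of the two exchanged entries gives terms that already match with
      opposite signs; only deletions from \<open>bs\<close> need the hypothesis on
      \<open>f\<close>.\<close>
    have "f (x # y # zs) = - f (y # x # zs)" for zs
      using alternatingD[OF Nil, of "[]" x y zs] by simp
    then have "face_sum (\<lambda>ys. f (x # y # ys)) bs = - face_sum (\<lambda>ys. f (y # x # ys)) bs"
      by (simp add: face_sum_uminus)
    then show ?case by simp
  next
    case (Cons a as)
    show ?case
      using Cons.IH[OF alternating_Cons[OF Cons.prems, of a]]
        alternatingD[OF Cons.prems, of as x y bs]
      by simp
  qed
  then show ?thesis unfolding alternating_def by blast
qed

lemma coboundary_closed:
  assumes "f \<in> aug_cochains K m"
  shows "coboundary K f \<in> aug_cochains K (Suc m)"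
proof -
  have "length xs = Suc m" if "face_sum f xs \<noteq> 0" for xs
  proof (rule ccontr)
    assume "length xs \<noteq> Suc m"
    \<comment> \<open>Every face has a length other than \<open>m\<close>, so \<open>f\<close>
      vanishes on all of them.\<close>
    then have "face_sum f xs = face_sum (\<lambda>_. 0) xs"
      by (intro face_sum_cong) (use aug_cochains_support[OF assms] in fastforce)
    then show False using that by simp
  qed
  moreover have "coboundary K f (as @ x # y # bs) = - coboundary K f (as @ y # x # bs)" for as x y bs
    using alternatingD[OF alternating_face_sum[OF aug_cochains_alternating[OF assms]], of as x y bs]
    by (auto simp: coboundary_eq insert_commute)
  then have "alternating (coboundary K f)"
    unfolding alternating_def by blast
  ultimately show ?thesis
    by (auto simp: aug_cochains_def coboundary_eq split: if_splits)
qed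

lemma additive_coboundary: "additive (coboundary K)"
proof
  show "coboundary K (f + g) = coboundary K f + coboundary K g" for f g
    by (rule ext) (simp add: coboundary_eq face_sum_add plus_fun_def)
qed

lemmas coboundary_additive [simp] =
  additive.add[OF additive_coboundary] additive.diff[OF additive_coboundary]
  additive.zero[OF additive_coboundary] additive.minus[OF additive_coboundary]
  additive.sum[OF additive_coboundary] additive_of_nat_times[OF additive_coboundary]

lemma coboundary_coboundary:
  assumes "simplicial_complex K"
  shows "coboundary K (coboundary K f) = 0"
proof
  fix xs
  have "face_sum (coboundary K f) xs = face_sum (face_sum f) xs"
    if "distinct xs" "set xs \<in> K"
    by (rule face_sum_cong) (use that assms in \<open>auto simp: coboundary_eq simplicial_complex_def\<close>)
  then show "coboundary K (coboundary K f) xs = 0 xs"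
    by (auto simp: coboundary_eq face_sum_face_sum pointwise)
qed

text \<open>The augmentation, with value 1 on the empty simplex. Its coboundary is the cochain 1, so
  a resolution of 1 can be started here, one step earlier.\<close>

definition aug_unit :: "'a list \<Rightarrow> int" where
  "aug_unit xs = (if xs = [] then 1 else 0)"

lemma aug_unit_cochain: "simplicial_complex K \<Longrightarrow> aug_unit \<in> aug_cochains K 0"
  by (auto simp: aug_cochains_def alternating_def aug_unit_def simplicial_complex_def)

lemma coboundary_aug_unit: "coboundary K aug_unit = unit_cochain K"
proof
  fix xs
  show "coboundary K aug_unit xs = unit_cochain K xs"
  proof (cases xs)
    case Nil
    then show ?thesis by (simp add: coboundary_eq unit_cochain_def ordered_simplices_def)
  next
    case (Cons x ys)
    have "face_sum aug_unit (x # ys) = (if ys = [] then 1 else 0)"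
      by (simp add: aug_unit_def)
    then show ?thesis
      using Cons by (auto simp: coboundary_eq unit_cochain_def ordered_simplices_def)
  qed
qed


section \<open>The action of the cyclic group\<close>

lemma additive_t_op: "additive (t_op K t)"
proof
  show "t_op K t (f + g) = t_op K t f + t_op K t g" for f g
    by (rule ext) (simp add: t_op_def pointwise)
qed

lemma additive_t_op_funpow: "additive (t_op K t ^^ k)"
proof (induction k)
  case 0
  show ?case by (simp add: additive_def)
next
  case (Suc k)
  show ?case
    by (simp add: additive_def additive.add[OF Suc] additive.add[OF additive_t_op])
qed

lemma additive_d_op: "additive (d_op K t)"
  by (simp add: additive_def d_op_def additive.add[OF additive_t_op])

lemma additive_s_op: "additive (s_op p K t)"
  by (simp add: additive_def s_op_def additive.add[OF additive_t_op_funpow] sum.distrib)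

text \<open>
  With shifted degrees, a resolution satisfies \<open>\<delta>\<phi>\<^sub>i = s\<phi>\<^sub>i\<^sub>+\<^sub>1\<close> or
  \<open>d\<phi>\<^sub>i\<^sub>+\<^sub>1\<close> according to whether \<open>i + 1\<close> is odd or even.
\<close>

definition res_op :: "nat \<Rightarrow> 'a set set \<Rightarrow> ('a \<Rightarrow> 'a) \<Rightarrow> nat \<Rightarrow> ('a list \<Rightarrow> int) \<Rightarrow> 'a list \<Rightarrow> int" where
  "res_op p K t i = (if odd i then s_op p K t else d_op K t)"

lemma additive_res_op: "additive (res_op p K t i)"
  by (simp add: res_op_def additive_d_op additive_s_op)

lemmas operators_additive [simp] =
  additive.add[OF additive_t_op] additive.diff[OF additive_t_op]
  additive.zero[OF additive_t_op] additive.minus[OF additive_t_op]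
  additive.sum[OF additive_t_op] additive_of_nat_times[OF additive_t_op]
  additive.add[OF additive_t_op_funpow] additive.diff[OF additive_t_op_funpow]
  additive.zero[OF additive_t_op_funpow] additive.minus[OF additive_t_op_funpow]
  additive.sum[OF additive_t_op_funpow] additive_of_nat_times[OF additive_t_op_funpow]
  additive.add[OF additive_d_op] additive.diff[OF additive_d_op]
  additive.zero[OF additive_d_op] additive.minus[OF additive_d_op]
  additive.sum[OF additive_d_op] additive_of_nat_times[OF additive_d_op]
  additive.add[OF additive_s_op] additive.diff[OF additive_s_op]
  additive.zero[OF additive_s_op] additive.minus[OF additive_s_op]
  additive.sum[OF additive_s_op] additive_of_nat_times[OF additive_s_op]
  additive.add[OF additive_res_op] additive.diff[OF additive_res_op]
  additive.zero[OF additive_res_op] additive.minus[OF additive_res_op]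
  additive.sum[OF additive_res_op] additive_of_nat_times[OF additive_res_op]

text \<open>Telescoping in the group ring: 1 - t^k factors as (1 - t)(1 + t + ... +
  t^(k-1)).\<close>

lemma d_op_geometric_sum: "d_op K t (\<Sum>j<k. (t_op K t ^^ j) f) = f - (t_op K t ^^ k) f"
proof (induction k)
  case 0
  show ?case by simp
next
  case (Suc k)
  have "d_op K t (\<Sum>j<Suc k. (t_op K t ^^ j) f) =
      d_op K t (\<Sum>j<k. (t_op K t ^^ j) f) + d_op K t ((t_op K t ^^ k) f)"
    by (simp only: sum.lessThan_Suc additive.add[OF additive_d_op])
  then show ?case by (simp only: Suc) (simp add: d_op_def)
qed

locale zp_complex =
  fixes p :: nat and K :: "'a set set" and t :: "'a \<Rightarrow> 'a"
  assumes zp: "Zp_complex p K t" and p_pos: "p > 0"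
begin

abbreviation "T \<equiv> t_op K t"
abbreviation "d \<equiv> d_op K t"
abbreviation "s \<equiv> s_op p K t"
abbreviation "R \<equiv> res_op p K t"
abbreviation "\<delta> \<equiv> coboundary K"
abbreviation "F \<equiv> aug_cochains K"

lemma complex: "simplicial_complex K"
  using zp by (simp add: Zp_complex_def)

lemma coboundary_coboundary' [simp]: "\<delta> (\<delta> f) = 0"
  by (rule coboundary_coboundary[OF complex])

lemma image_simplex: "\<sigma> \<in> K \<Longrightarrow> t ` \<sigma> \<in> K"
  using zp unfolding Zp_complex_def simplicial_automorphism_def by (meson Union_upper)

lemma funpow_image_simplex: "\<sigma> \<in> K \<Longrightarrow> (t ^^ k) ` \<sigma> \<in> K"
proof (induction k)
  case (Suc k)
  then show ?case using image_simplex[of "(t ^^ k) ` \<sigma>"] by (simp add: image_image)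
qed simp

lemma inj_on_simplex: "\<sigma> \<in> K \<Longrightarrow> inj_on t \<sigma>"
  using zp unfolding Zp_complex_def simplicial_automorphism_def bij_betw_def
  by (meson Union_upper inj_on_subset)

lemma funpow_p_image: "\<sigma> \<in> K \<Longrightarrow> (t ^^ p) ` \<sigma> = \<sigma>"
  using zp by (force simp: Zp_complex_def)

lemma funpow_p_map: "set xs \<in> K \<Longrightarrow> map (t ^^ p) xs = xs"
  using zp by (auto simp: Zp_complex_def intro!: map_idI)

lemma free: "\<sigma> \<in> K \<Longrightarrow> \<sigma> \<noteq> {} \<Longrightarrow> (t ^^ k) ` \<sigma> = \<sigma> \<Longrightarrow> p dvd k"
  using zp by (auto simp: Zp_complex_def)

lemma t_op_closed:
  assumes "f \<in> F m"
  shows "T f \<in> F m"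
proof -
  have "T f (as @ x # y # bs) = - T f (as @ y # x # bs)" for as x y bs
    using alternatingD[OF aug_cochains_alternating[OF assms], of "map t as" "t x" "t y" "map t bs"]
    by (simp add: t_op_def insert_commute)
  then have "alternating (T f)" unfolding alternating_def by blast
  moreover have "length xs = m \<and> distinct xs \<and> set xs \<in> K" if "T f xs \<noteq> 0" for xs
  proof -
    have "set xs \<in> K" "f (map t xs) \<noteq> 0" using that by (auto simp: t_op_def split: if_splits)
    then show ?thesis
      using aug_cochains_support[OF assms, of "map t xs"] by (auto simp: distinct_map)
  qed
  ultimately show ?thesis by (simp add: aug_cochains_def)
qed

lemma t_op_funpow_closed: "f \<in> F m \<Longrightarrow> (T ^^ k) f \<in> F m"
  by (induction k) (auto intro: t_op_closed)

lemma d_op_closed: "f \<in> F m \<Longrightarrow> d f \<in> F m"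
  by (simp add: d_op_def aug_cochains_diff t_op_closed)

lemma s_op_closed: "f \<in> F m \<Longrightarrow> s f \<in> F m"
  by (simp add: s_op_def aug_cochains_sum t_op_funpow_closed)

lemma res_op_closed: "f \<in> F m \<Longrightarrow> R i f \<in> F m"
  by (simp add: res_op_def d_op_closed s_op_closed)

lemma t_op_coboundary: "T (\<delta> f) = \<delta> (T f)"
proof
  fix xs
  show "T (\<delta> f) xs = \<delta> (T f) xs"
  proof (cases "set xs \<in> K")
    case True
    have "face_sum (T f) xs = face_sum (\<lambda>ys. f (map t ys)) xs"
      by (rule face_sum_cong) (use True complex in \<open>auto simp: t_op_def simplicial_complex_def\<close>)
    then show ?thesis
      using True image_simplex[OF True] inj_on_simplex[OF True]
      by (simp add: t_op_def coboundary_eq face_sum_map distinct_map)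
  qed (simp add: t_op_def coboundary_eq)
qed

lemma t_op_funpow_coboundary: "(T ^^ k) (\<delta> f) = \<delta> ((T ^^ k) f)"
  by (induction k) (simp_all add: t_op_coboundary)

lemma d_op_coboundary: "d (\<delta> f) = \<delta> (d f)"
  by (simp add: d_op_def t_op_coboundary)

lemma s_op_coboundary: "s (\<delta> f) = \<delta> (s f)"
  by (simp add: s_op_def t_op_funpow_coboundary)

lemma res_op_coboundary: "R i (\<delta> f) = \<delta> (R i f)"
  by (simp add: res_op_def d_op_coboundary s_op_coboundary)

lemma t_op_funpow_apply:
  assumes "f \<in> F m"
  shows "(T ^^ k) f xs = (if set xs \<in> K then f (map (t ^^ k) xs) else 0)"
proof (induction k arbitrary: xs)
  case 0
  show ?case using aug_cochains_support[OF assms, of xs] by auto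
next
  case (Suc k)
  have "(T ^^ Suc k) f xs = (if set xs \<in> K then (T ^^ k) f (map t xs) else 0)"
    by (simp add: t_op_def)
  then show ?case
    using image_simplex[of "set xs"] by (simp add: Suc.IH funpow_swap1 comp_def)
qed

lemma t_op_funpow_p: "f \<in> F m \<Longrightarrow> (T ^^ p) f = f"
  by (rule ext) (use aug_cochains_support in \<open>force simp: t_op_funpow_apply funpow_p_map\<close>)

lemma s_op_t_op: "f \<in> F m \<Longrightarrow> s (T f) = s f"
proof -
  assume f: "f \<in> F m"
  \<comment> \<open>The sum with \<open>p + 1\<close> terms is split at either end; its last term is
    \<open>f\<close> again because t^p acts trivially.\<close>
  have "s (T f) + f = (\<Sum>k<Suc p. (T ^^ k) f)"
    by (subst sum.lessThan_Suc_shift) (simp add: s_op_def funpow_swap1)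
  also have "\<dots> = s f + f"
    by (simp add: s_op_def t_op_funpow_p[OF f])
  finally show ?thesis by simp
qed

lemma t_op_s_op: "f \<in> F m \<Longrightarrow> T (s f) = s f"
  using s_op_t_op[of f m] by (simp add: s_op_def funpow_swap1)

lemma s_op_d_op: "f \<in> F m \<Longrightarrow> s (d f) = 0"
  by (simp add: d_op_def s_op_t_op)

lemma d_op_s_op: "f \<in> F m \<Longrightarrow> d (s f) = 0"
  by (simp add: d_op_def t_op_s_op)

lemma res_op_res_op: "f \<in> F m \<Longrightarrow> R (Suc i) (R i f) = 0"
  by (auto simp: res_op_def s_op_d_op d_op_s_op)

section \<open>Orbits of simplices and exactness of the sequence of \<open>d\<close> and
  \<open>s\<close>\<close>

definition orbit :: "'a set \<Rightarrow> 'a set set" where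
  "orbit \<sigma> = range (\<lambda>k. (t ^^ k) ` \<sigma>)"

text \<open>A fundamental domain: the choice depends only on the orbit as a set, so exactly one
  simplex is picked in each orbit of simplices.\<close>

definition representatives :: "'a set set" where
  "representatives = {\<sigma>. \<sigma> = (SOME \<tau>. \<tau> \<in> orbit \<sigma>)}"

lemma funpow_image: "(t ^^ m) ` (t ^^ n) ` \<sigma> = (t ^^ (m + n)) ` \<sigma>"
  by (simp add: funpow_add image_comp)

lemma funpow_mod_image:
  assumes "\<sigma> \<in> K"
  shows "(t ^^ (k mod p)) ` \<sigma> = (t ^^ k) ` \<sigma>"
proof -
  have "(t ^^ (n + p * q)) ` \<sigma> = (t ^^ n) ` \<sigma>" for n q
  proof (induction q)
    case (Suc q)
    have "(t ^^ (n + p * Suc q)) ` \<sigma> = (t ^^ (n + p * q)) ` (t ^^ p) ` \<sigma>"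
      by (simp add: funpow_image add_ac)
    then show ?case using Suc funpow_p_image[OF assms] by simp
  qed simp
  from this[of "k mod p" "k div p"] show ?thesis by simp
qed

lemma orbit_image:
  assumes "\<sigma> \<in> K"
  shows "orbit ((t ^^ k) ` \<sigma>) = orbit \<sigma>"
proof -
  have "(t ^^ m) ` \<sigma> \<in> orbit ((t ^^ k) ` \<sigma>)" for m
  proof -
    \<comment> \<open>Exponents are natural numbers, so t^(p*k - k) serves as the inverse of
      t^k.\<close>
    have "k \<le> p * k" using p_pos by (cases p) auto
    then have "m + (p * k - k) + k = m + p * k"
      by (metis add.assoc le_add_diff_inverse2)
    then have "(t ^^ (m + (p * k - k))) ` (t ^^ k) ` \<sigma> = (t ^^ (m + p * k)) ` \<sigma>"
      by (simp only: funpow_image)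
    also have "\<dots> = (t ^^ m) ` \<sigma>"
      using funpow_mod_image[OF assms, of "m + p * k"] funpow_mod_image[OF assms, of m] by simp
    finally show ?thesis
      unfolding orbit_def by (metis rangeI)
  qed
  then show ?thesis
    by (auto simp: orbit_def funpow_image)
qed

text \<open>Existence holds because \<open>representatives\<close> meets each orbit; uniqueness is
  freeness of the action. The exponent \<open>p - j\<close> undoes a translation by
  \<open>j\<close>.\<close>

lemma ex1_representative:
  assumes \<sigma>: "\<sigma> \<in> K" "\<sigma> \<noteq> {}"
  shows "\<exists>!j. j < p \<and> (t ^^ (p - j)) ` \<sigma> \<in> representatives"
proof -
  define \<tau> where "\<tau> = (SOME \<tau>. \<tau> \<in> orbit \<sigma>)"
  have rep: "(t ^^ k) ` \<sigma> \<in> representatives \<longleftrightarrow> (t ^^ k) ` \<sigma> = \<tau>" for k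
    by (simp add: representatives_def orbit_image[OF \<sigma>(1)] \<tau>_def)
  have "\<tau> \<in> orbit \<sigma>"
    unfolding \<tau>_def by (rule someI[of _ "(t ^^ 0) ` \<sigma>"]) (unfold orbit_def, rule rangeI)
  then obtain k where k: "\<tau> = (t ^^ k) ` \<sigma>"
    by (auto simp: orbit_def)
  \<comment> \<open>Chosen with \<open>p - j\<close> congruent to \<open>k\<close> modulo
    \<open>p\<close>; if \<open>p\<close> divides \<open>k\<close>, this is \<open>j = 0\<close>,
    where t^p acts as the identity.\<close>
  define j where "j = (if k mod p = 0 then 0 else p - k mod p)"
  have "j < p" using p_pos by (simp add: j_def)
  moreover have "(t ^^ (p - j)) ` \<sigma> = \<tau>"
    using funpow_mod_image[OF \<sigma>(1), of k] funpow_p_image[OF \<sigma>(1)] p_pos k by (auto simp: j_def less_imp_le)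
  moreover have "i = j" if "i \<le> j" "j < p" "(t ^^ (p - i)) ` \<sigma> = (t ^^ (p - j)) ` \<sigma>" for i j
  proof -
    have "(t ^^ (j - i)) ` (t ^^ (p - j)) ` \<sigma> = (t ^^ (p - j)) ` \<sigma>"
      using that by (simp add: funpow_image)
    then have "p dvd j - i"
      by (intro free[of "(t ^^ (p - j)) ` \<sigma>"]) (use \<sigma> in \<open>auto intro: funpow_image_simplex\<close>)
    then show ?thesis
      using that by (metis diff_is_0_eq dvd_imp_le le_antisym less_imp_diff_less not_less neq0_conv)
  qed
  ultimately show ?thesis
    unfolding rep by (metis nat_le_linear)
qed

definition restrict_rep :: "('a list \<Rightarrow> int) \<Rightarrow> 'a list \<Rightarrow> int" where
  "restrict_rep f xs = (if set xs \<in> representatives then f xs else 0)"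

lemma restrict_rep_closed:
  assumes "f \<in> F m"
  shows "restrict_rep f \<in> F m"
proof -
  have "restrict_rep f (as @ x # y # bs) = - restrict_rep f (as @ y # x # bs)" for as x y bs
    using alternatingD[OF aug_cochains_alternating[OF assms], of as x y bs]
    by (simp add: restrict_rep_def insert_commute)
  then have "alternating (restrict_rep f)" unfolding alternating_def by blast
  then show ?thesis
    using aug_cochains_support[OF assms] by (auto simp: aug_cochains_def restrict_rep_def)
qed

lemma additive_restrict_rep: "additive restrict_rep"
proof
  show "restrict_rep (f + g) = restrict_rep f + restrict_rep g" for f g
    by (rule ext) (simp add: restrict_rep_def pointwise)
qed

text \<open>In positive degree the cochains form a free module over the group ring: each summand is
  the part of \<open>f\<close> on one translate of the fundamental domain, written as a translate of
  a cochain on the domain. The empty simplex, being fixed by \<open>t\<close>, is excluded by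
  \<open>m > 0\<close>.\<close>

lemma sum_restrict_rep:
  assumes f: "f \<in> F m" and "m > 0"
  shows "f = (\<Sum>j<p. (T ^^ (p - j)) (restrict_rep ((T ^^ j) f)))"
proof
  fix xs
  have "(T ^^ (p - j)) (restrict_rep ((T ^^ j) f)) xs =
      (if (t ^^ (p - j)) ` set xs \<in> representatives then f xs else 0)" if "j < p" for j
  proof (cases "set xs \<in> K")
    case True
    have "f (map (t ^^ j) (map (t ^^ (p - j)) xs)) = f xs"
      using that funpow_p_map[OF True] by (simp add: funpow_add[symmetric] o_def[symmetric])
    then show ?thesis
      using True t_op_funpow_apply[OF restrict_rep_closed[OF t_op_funpow_closed[OF f]]]
        t_op_funpow_apply[OF f] funpow_image_simplex[OF True]
      by (simp add: restrict_rep_def)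
  next
    case False
    then show ?thesis
      using t_op_funpow_apply[OF restrict_rep_closed[OF t_op_funpow_closed[OF f]]]
        aug_cochains_support[OF f, of xs] by auto
  qed
  then have "(\<Sum>j<p. (T ^^ (p - j)) (restrict_rep ((T ^^ j) f))) xs =
      (\<Sum>j<p. if (t ^^ (p - j)) ` set xs \<in> representatives then f xs else 0)"
    by (simp add: sum_fun_apply)
  also have "\<dots> = f xs"
  proof (cases "f xs = 0")
    case False
    then have "set xs \<in> K" "set xs \<noteq> {}"
      using aug_cochains_support[OF f, of xs] \<open>m > 0\<close> by auto
    then obtain j where j: "j < p"
        "\<And>i. i < p \<Longrightarrow> (t ^^ (p - i)) ` set xs \<in> representatives \<longleftrightarrow> i = j"
      using ex1_representative[of "set xs"] by blast
    then have "(\<Sum>i<p. if (t ^^ (p - i)) ` set xs \<in> representatives then f xs else 0) =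
        (\<Sum>i<p. if i = j then f xs else 0)"
      by (intro sum.cong) auto
    then show ?thesis using j(1) by simp
  qed (simp add: sum.neutral)
  finally show "f xs = (\<Sum>j<p. (T ^^ (p - j)) (restrict_rep ((T ^^ j) f))) xs" by simp
qed

lemma kernel_d_op:
  assumes f: "f \<in> F m" and "m > 0" "d f = 0"
  shows "\<exists>x\<in>F m. f = s x"
proof
  have "T f = f" using assms by (simp add: d_op_def)
  then have "(T ^^ j) f = f" for j by (induction j) auto
  \<comment> \<open>For invariant \<open>f\<close> all coordinates agree. The exponents run through
    p, ..., 1 instead of p - 1, ..., 0; the extra \<open>T\<close> is absorbed by the norm.\<close>
  then have "f = (\<Sum>j<p. (T ^^ (p - j)) (restrict_rep f))"
    using sum_restrict_rep[OF f \<open>m > 0\<close>] by simp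
  also have "\<dots> = (\<Sum>j<p. (T ^^ Suc j) (restrict_rep f))"
    by (rule sum.reindex_bij_witness[of _ "\<lambda>j. p - Suc j" "\<lambda>j. p - Suc j"])
      (auto simp: Suc_diff_Suc simp del: funpow.simps)
  also have "\<dots> = T (s (restrict_rep f))" by (simp add: s_op_def)
  also have "\<dots> = s (restrict_rep f)" by (rule t_op_s_op[OF restrict_rep_closed[OF f]])
  finally show "f = s (restrict_rep f)" .
qed (rule restrict_rep_closed[OF f])

lemma kernel_s_op:
  assumes f: "f \<in> F m" and "m > 0" "s f = 0"
  shows "\<exists>x\<in>F m. f = d x"
proof
  \<comment> \<open>The coordinates \<open>g j\<close> of \<open>f\<close> add up to zero because
    \<open>s f = 0\<close>, so \<open>f\<close> is minus the sum of the
    \<open>g j - (T ^^ (p - j)) (g j)\<close>. Each of these is divisible by 1 - t, with the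
    geometric sum that enters \<open>x\<close> as quotient.\<close>
  define g where "g = (\<lambda>j. restrict_rep ((T ^^ j) f))"
  define x where "x = - (\<Sum>j<p. \<Sum>i<p - j. (T ^^ i) (g j))"
  have g: "g j \<in> F m" for j
    unfolding g_def by (intro restrict_rep_closed t_op_funpow_closed f)
  have "(\<Sum>j<p. g j) = restrict_rep (s f)"
    by (simp add: g_def s_op_def additive.sum[OF additive_restrict_rep])
  then have sum_g: "(\<Sum>j<p. g j) = 0"
    by (simp add: \<open>s f = 0\<close> additive.zero[OF additive_restrict_rep])
  have "f = (\<Sum>j<p. (T ^^ (p - j)) (g j))"
    using sum_restrict_rep[OF f \<open>m > 0\<close>] by (simp add: g_def)
  also have "\<dots> = - (\<Sum>j<p. g j - (T ^^ (p - j)) (g j))"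
    by (simp only: sum_subtractf sum_g) simp
  also have "\<dots> = d x"
    unfolding x_def additive.minus[OF additive_d_op]
    by (subst additive.sum[OF additive_d_op]) (simp only: d_op_geometric_sum)
  finally show "f = d x" .
  show "x \<in> F m"
    unfolding x_def by (intro aug_cochains_uminus aug_cochains_sum t_op_funpow_closed g)
qed

text \<open>Exactness of the two-periodic sequence of \<open>d\<close> and \<open>s\<close>; the
  recursive constructions of resolutions and of homotopies lift through it.\<close>

lemma kernel_res_op:
  assumes "f \<in> F m" "m > 0" "R (Suc i) f = 0"
  shows "\<exists>x\<in>F m. f = R i x"
  using assms kernel_d_op kernel_s_op by (auto simp: res_op_def split: if_splits)

end


section \<open>Smith classes and resolutions\<close>

locale additive_complex =
  fixes A :: "nat \<Rightarrow> 'c::ring_1 set" and \<delta> :: "'c \<Rightarrow> 'c"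
  assumes additive: "additive \<delta>"
    and zero: "0 \<in> A i"
    and diff: "x \<in> A i \<Longrightarrow> y \<in> A i \<Longrightarrow> x - y \<in> A i"
    and differential: "x \<in> A i \<Longrightarrow> \<delta> x \<in> A (Suc i)"
begin

abbreviation G :: "nat \<Rightarrow> 'c monoid" where
  "G i \<equiv> additive_group (A i)"

definition B :: "nat \<Rightarrow> 'c set" where
  "B i = (case i of 0 \<Rightarrow> {0} | Suc j \<Rightarrow> \<delta> ` A j)"

definition M :: "nat \<Rightarrow> nat \<Rightarrow> 'c set" where
  "M n i = (\<lambda>y. of_nat n * y) ` A i"

definition mod_coset :: "nat \<Rightarrow> nat \<Rightarrow> 'c \<Rightarrow> 'c set" where
  "mod_coset n i z = (\<lambda>m. m + z) ` M n i"

lemma coboundaries_eq: "coboundaries G (\<lambda>_. \<delta>) i = B i"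
  by (simp add: coboundaries_def B_def additive_group_def split: nat.split)

lemma multiples_eq: "multiples n (G i) = M n i"
proof -
  have "x [^]\<^bsub>G i\<^esub> n = of_nat n * x" for x
    by (induction n) (simp_all add: nat_pow_def additive_group_def distrib_right add.commute)
  then show ?thesis by (simp add: multiples_def M_def additive_group_def)
qed

lemma r_coset_eq: "X #>\<^bsub>G i\<^esub> z = (\<lambda>x. x + z) ` X"
  by (auto simp: r_coset_def additive_group_def)

lemma set_mult_eq: "X <#>\<^bsub>G i\<^esub> Y = {x + y |x y. x \<in> X \<and> y \<in> Y}"
  by (auto simp: set_mult_def additive_group_def)

lemma add: "x \<in> A i \<Longrightarrow> y \<in> A i \<Longrightarrow> x + y \<in> A i"
  using diff[of x i "0 - y"] diff[of 0 i y] zero[of i] by simp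

lemma zero_B: "0 \<in> B i"
  using zero additive.zero[OF additive] by (auto simp: B_def image_iff split: nat.split)

lemma diff_B: "x \<in> B i \<Longrightarrow> y \<in> B i \<Longrightarrow> x - y \<in> B i"
  using diff additive.diff[OF additive] by (auto simp: B_def image_iff split: nat.splits) metis

lemma add_B: "x \<in> B i \<Longrightarrow> y \<in> B i \<Longrightarrow> x + y \<in> B i"
  using diff_B[of x i "0 - y"] diff_B[of 0 i y] zero_B[of i] by simp

lemma B_translate: "z \<in> B i \<Longrightarrow> (\<lambda>b. b + z) ` B i = B i"
  using add_B diff_B by (force intro: image_eqI[of _ _ "x - z" for x])

lemma zero_M: "0 \<in> M n i"
  using zero by (force simp: M_def)

lemma diff_M: "x \<in> M n i \<Longrightarrow> y \<in> M n i \<Longrightarrow> x - y \<in> M n i"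
  using diff by (auto simp: M_def simp flip: right_diff_distrib)

lemma add_M: "x \<in> M n i \<Longrightarrow> y \<in> M n i \<Longrightarrow> x + y \<in> M n i"
  using diff_M[of x n i "0 - y"] diff_M[of 0 n i y] zero_M[of n i] by simp

lemma differential_M: "x \<in> M n i \<Longrightarrow> \<delta> x \<in> M n (Suc i)"
  using differential by (auto simp: M_def additive_of_nat_times[OF additive])

lemma mod_coset_zero: "mod_coset n i 0 = M n i"
  by (simp add: mod_coset_def)

lemma mod_coset_absorb:
  assumes "m \<in> M n i"
  shows "mod_coset n i (m + z) = mod_coset n i z"
proof -
  have "x + z = (x - m) + (m + z)" "x + (m + z) = (x + m) + z" for x
    by (simp_all add: add.assoc)
  then show ?thesis
    unfolding mod_coset_def using assms add_M diff_M by (metis (no_types, lifting) image_eqI image_subsetI subset_antisym)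
qed

lemma mod_coset_set_mult:
  "mod_coset n i z <#>\<^bsub>G i\<^esub> mod_coset n i w = mod_coset n i (z + w)"
proof (intro equalityI subsetI)
  fix x assume "x \<in> mod_coset n i z <#>\<^bsub>G i\<^esub> mod_coset n i w"
  then obtain a b where "a \<in> M n i" "b \<in> M n i" "x = (a + z) + (b + w)"
    by (auto simp: set_mult_eq mod_coset_def)
  then show "x \<in> mod_coset n i (z + w)"
    using add_M[of a n i b] by (auto simp: mod_coset_def image_iff algebra_simps)
next
  fix x assume "x \<in> mod_coset n i (z + w)"
  then obtain a where a: "a \<in> M n i" "x = (a + z) + (0 + w)"
    by (auto simp: mod_coset_def add.assoc)
  then show "x \<in> mod_coset n i z <#>\<^bsub>G i\<^esub> mod_coset n i w"
    unfolding set_mult_eq mod_coset_def using zero_M[of n i] by blast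
qed

lemma mod_diff_mod_coset:
  "mod_diff n G (\<lambda>_. \<delta>) i (mod_coset n i z) = mod_coset n (Suc i) (\<delta> z)"
proof (intro equalityI subsetI)
  fix x assume "x \<in> mod_diff n G (\<lambda>_. \<delta>) i (mod_coset n i z)"
  then obtain a b where ab: "a \<in> M n (Suc i)" "b \<in> M n i" "x = a + \<delta> (b + z)"
    unfolding mod_diff_def multiples_eq set_mult_eq mod_coset_def by blast
  then have "x = (a + \<delta> b) + \<delta> z" "a + \<delta> b \<in> M n (Suc i)"
    by (simp_all add: additive.add[OF additive] add.assoc add_M differential_M)
  then show "x \<in> mod_coset n (Suc i) (\<delta> z)"
    by (simp add: mod_coset_def)
next
  fix x assume "x \<in> mod_coset n (Suc i) (\<delta> z)"
  then obtain a where "a \<in> M n (Suc i)" "x = a + \<delta> (0 + z)"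
    by (auto simp: mod_coset_def)
  then show "x \<in> mod_diff n G (\<lambda>_. \<delta>) i (mod_coset n i z)"
    unfolding mod_diff_def multiples_eq set_mult_eq mod_coset_def using zero_M[of n i] by blast
qed

lemma mod_coboundaries_eq:
  "coboundaries (mod_groups n G) (mod_diff n G (\<lambda>_. \<delta>)) i = mod_coset n i ` B i"
proof (cases i)
  case 0
  then show ?thesis
    by (simp add: coboundaries_def B_def mod_groups_def multiples_eq mod_coset_zero)
next
  case (Suc j)
  have "carrier (mod_groups n G j) = mod_coset n j ` A j"
    unfolding mod_groups_def carrier_FactGroup multiples_eq r_coset_eq mod_coset_def
    by (simp add: additive_group_def)
  then show ?thesis
    using Suc by (simp add: coboundaries_def B_def image_image mod_diff_mod_coset)
qed

lemma reduction_eq: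
  "reduction n G (\<lambda>_. \<delta>) i (cohomology_class G (\<lambda>_. \<delta>) i z) =
     (\<lambda>b. mod_coset n i (b + z)) ` B i"
proof -
  have "reduction n G (\<lambda>_. \<delta>) i (cohomology_class G (\<lambda>_. \<delta>) i z) =
      {mod_coset n i b <#>\<^bsub>G i\<^esub> mod_coset n i (b' + z) |b b'. b \<in> B i \<and> b' \<in> B i}"
    unfolding reduction_def cohomology_class_def mod_coboundaries_eq coboundaries_eq multiples_eq
      r_coset_eq mod_groups_def set_mult_def[of "G i Mod M n i"] mult_FactGroup
      mod_coset_def[symmetric]
    by blast
  also have "\<dots> = {mod_coset n i ((b + b') + z) |b b'. b \<in> B i \<and> b' \<in> B i}"
    by (simp add: mod_coset_set_mult add.assoc)
  also have "\<dots> = (\<lambda>b. mod_coset n i (b + z)) ` B i"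
    using add_B zero_B[of i] by (auto simp: image_iff) (metis add_0)
  finally show ?thesis .
qed

text \<open>The reduced class consists of the cosets of \<open>b + z\<close>, the zero class of the
  cosets of \<open>b\<close>, for \<open>b\<close> in \<open>B i\<close>. Taking
  \<open>b = 0\<close> in the former gives one direction; the other holds because translation by a
  coboundary permutes \<open>B i\<close>.\<close>

lemma reduction_zero_iff:
  "reduction n G (\<lambda>_. \<delta>) i (cohomology_class G (\<lambda>_. \<delta>) i z) =
     \<one>\<^bsub>cohomology (mod_groups n G) (mod_diff n G (\<lambda>_. \<delta>)) i\<^esub> \<longleftrightarrow>
   (\<exists>b\<in>B i. \<exists>y\<in>A i. z = b + of_nat n * y)"
proof -
  have "(\<lambda>b. mod_coset n i (b + z)) ` B i = mod_coset n i ` B i \<longleftrightarrow>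
      (\<exists>b\<in>B i. \<exists>m\<in>M n i. z = b + m)" (is "?l \<longleftrightarrow> ?r")
  proof
    assume ?l
    moreover have "mod_coset n i (0 + z) \<in> (\<lambda>b. mod_coset n i (b + z)) ` B i"
      using zero_B by (rule imageI)
    ultimately obtain b where b: "b \<in> B i" "mod_coset n i z = mod_coset n i b"
      by auto
    have "0 + z \<in> mod_coset n i z"
      unfolding mod_coset_def using zero_M by (rule imageI)
    then have "z \<in> mod_coset n i b" using b(2) by simp
    then show ?r using b(1) by (auto simp: mod_coset_def) (metis add.commute)
  next
    assume ?r
    then obtain b0 m where b0: "b0 \<in> B i" "m \<in> M n i" "z = b0 + m" by blast
    have "mod_coset n i (b + z) = mod_coset n i (b + b0)" for b
      using mod_coset_absorb[OF b0(2), of "b + b0"] b0(3) by (simp add: add_ac)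
    then have "(\<lambda>b. mod_coset n i (b + z)) ` B i = mod_coset n i ` ((\<lambda>b. b + b0) ` B i)"
      by (simp add: image_image)
    then show ?l using B_translate[OF b0(1)] by simp
  qed
  then show ?thesis
    by (simp add: reduction_eq cohomology_def mod_coboundaries_eq M_def)
qed

lemma class_zero:
  assumes "z \<in> B i"
  shows "cohomology_class G (\<lambda>_. \<delta>) i z = \<one>\<^bsub>cohomology G (\<lambda>_. \<delta>) i\<^esub>"
  using B_translate[OF assms]
  by (simp add: cohomology_class_def cohomology_def coboundaries_eq r_coset_eq)

end

section \<open>Existence and uniqueness of resolutions\<close>

context zp_complex
begin

lemma t_op_aug_unit: "T aug_unit = aug_unit"
  using complex by (auto simp: fun_eq_iff t_op_def aug_unit_def simplicial_complex_def)

text \<open>Putting the augmentation at index 0 turns the normalisation and the two parity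
  conditions of \<open>resolution\<close> into one recursion.\<close>

definition aug_resolution :: "(nat \<Rightarrow> 'a list \<Rightarrow> int) \<Rightarrow> bool" where
  "aug_resolution f \<longleftrightarrow> f 0 = aug_unit \<and> (\<forall>i. f i \<in> F i) \<and>
     (\<forall>i. \<delta> (f i) = R (Suc i) (f (Suc i)))"

lemma resolution_iff: "resolution p K t \<phi> \<longleftrightarrow> aug_resolution (case_nat aug_unit \<phi>)"
proof -
  have all: "(\<forall>i. P i) \<longleftrightarrow> P 0 \<and> (\<forall>i. P (Suc i))" for P :: "nat \<Rightarrow> bool"
    by (metis nat.exhaust)
  show ?thesis
    unfolding resolution_def aug_resolution_def
    by (subst (3 4) all)
      (simp add: res_op_def cochains_eq coboundary_aug_unit aug_unit_cochain[OF complex]; metis)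
qed

lemma res_op_Suc_Suc: "R (Suc (Suc i)) = R i"
  by (simp add: res_op_def)

text \<open>Since \<open>R\<close> has period two, \<open>R (i + 2)\<close> kills
  \<open>\<delta> y\<close>, and exactness yields \<open>z\<close> with
  \<open>\<delta> y = R (i + 1) z\<close>. Then
  \<open>\<delta> (R (i + 1) z) = \<delta> (\<delta> y) = 0\<close>, which is the same condition one
  step later.\<close>

lemma extend_resolution:
  assumes "y \<in> F i" "i > 0" "\<delta> (R i y) = 0"
  shows "\<exists>h. h i = y \<and> (\<forall>j\<ge>i. h j \<in> F j \<and> \<delta> (h j) = R (Suc j) (h (Suc j)))"
proof -
  have "\<exists>g. \<forall>n. (g n \<in> F (i + n) \<and> \<delta> (R (i + n) (g n)) = 0 \<and> (n = 0 \<longrightarrow> g n = y)) \<and>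
      \<delta> (g n) = R (Suc (i + n)) (g (Suc n))"
  proof (rule dependent_nat_choice)
    show "\<exists>x. x \<in> F (i + 0) \<and> \<delta> (R (i + 0) x) = 0 \<and> ((0::nat) = 0 \<longrightarrow> x = y)"
      using assms by auto
  next
    fix x n assume x: "x \<in> F (i + n) \<and> \<delta> (R (i + n) x) = 0 \<and> (n = 0 \<longrightarrow> x = y)"
    then have "R (Suc (Suc (i + n))) (\<delta> x) = 0"
      by (simp add: res_op_coboundary res_op_Suc_Suc)
    then obtain z where "z \<in> F (Suc (i + n))" "\<delta> x = R (Suc (i + n)) z"
      using kernel_res_op[OF coboundary_closed[of x]] x by blast
    then show "\<exists>z. (z \<in> F (i + Suc n) \<and> \<delta> (R (i + Suc n) z) = 0 \<and> (Suc n = 0 \<longrightarrow> z = y)) \<and>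
        \<delta> x = R (Suc (i + n)) z"
      by (metis add_Suc_right coboundary_coboundary' nat.distinct(1))
  qed
  then obtain g where g: "\<And>n. g n \<in> F (i + n)" "g 0 = y"
      "\<And>n. \<delta> (g n) = R (Suc (i + n)) (g (Suc n))"
    by metis
  show ?thesis
    by (rule exI[of _ "\<lambda>j. g (j - i)"])
      (use g in \<open>auto simp: Suc_diff_le\<close>, (metis le_add_diff_inverse)+)
qed

lemma ex_aug_resolution: "\<exists>f. aug_resolution f"
proof -
  have "d (\<delta> aug_unit) = 0"
    by (simp add: d_op_coboundary) (simp add: d_op_def t_op_aug_unit)
  then obtain y where y: "y \<in> F (Suc 0)" "\<delta> aug_unit = s y"
    using kernel_d_op[OF coboundary_closed[OF aug_unit_cochain[OF complex]]] by blast
  then have "\<delta> (R 1 y) = 0"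
    by (metis coboundary_coboundary' odd_one res_op_def)
  then obtain h where h: "h 1 = y" "\<And>j. j \<ge> 1 \<Longrightarrow> h j \<in> F j"
      "\<And>j. j \<ge> 1 \<Longrightarrow> \<delta> (h j) = R (Suc j) (h (Suc j))"
    using extend_resolution[of y 1] y(1) by auto
  \<comment> \<open>\<open>h\<close> is unspecified at index 0, where the augmentation is put
    in.\<close>
  have "aug_resolution (\<lambda>j. if j = 0 then aug_unit else h j)"
    using h y aug_unit_cochain[OF complex] by (auto simp: aug_resolution_def res_op_def)
  then show ?thesis by blast
qed

text \<open>A homotopy between the two resolutions, built by lifting one index at a time: the next
  cocycle \<open>w\<close> is the coboundary of the present \<open>x\<close>. The clause for
  \<open>n = 0\<close> reflects that there are no coboundaries to divide by in dimension 0.\<close>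

lemma aug_resolution_unique:
  assumes f: "aug_resolution f" and g: "aug_resolution g"
  shows "\<exists>w x. x \<in> F n \<and> f n - g n = w + R (Suc n) x \<and> \<delta> w = 0 \<and> (n = 0 \<longrightarrow> x = 0)"
proof (induction n)
  case 0
  show ?case
    using f g by (intro exI[of _ 0]) (simp add: aug_resolution_def aug_cochains_zero)
next
  case (Suc n)
  then obtain w x where x: "x \<in> F n" "f n - g n = w + R (Suc n) x" "\<delta> w = 0" by blast
  have "R (Suc n) (f (Suc n) - g (Suc n)) = \<delta> (f n - g n)"
    using f g by (simp add: aug_resolution_def)
  also have "\<dots> = R (Suc n) (\<delta> x)"
    using x by (simp add: res_op_coboundary)
  finally have "R (Suc n) (f (Suc n) - g (Suc n) - \<delta> x) = 0" by simp
  moreover have "f (Suc n) - g (Suc n) - \<delta> x \<in> F (Suc n)"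
    using f g x by (intro aug_cochains_diff coboundary_closed) (auto simp: aug_resolution_def)
  ultimately obtain x' where "x' \<in> F (Suc n)" "f (Suc n) - g (Suc n) - \<delta> x = R n x'"
    using kernel_res_op by blast
  then show ?case
    by (intro exI[of _ "\<delta> x"] exI[of _ x']) (simp add: res_op_Suc_Suc algebra_simps)
qed

section \<open>Smith classes in terms of a resolution\<close>

text \<open>
  The \<open>n\<close>-th Smith class is represented by \<open>\<delta> (f n)\<close>; for \<open>q = 0\<close> the predicate expresses that
  the integral class vanishes.
\<close>

definition vanishes_mod :: "nat \<Rightarrow> (nat \<Rightarrow> 'a list \<Rightarrow> int) \<Rightarrow> nat \<Rightarrow> bool" where
  "vanishes_mod q f n \<longleftrightarrow> (\<exists>x\<in>F n. \<exists>y\<in>F (Suc n). (n = 0 \<longrightarrow> x = 0) \<and>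
     \<delta> (f n) = \<delta> (R (Suc n) x) + of_nat q * R (Suc n) y)"

lemma vanishes_mod_independent:
  assumes "aug_resolution f" "aug_resolution g" "vanishes_mod q f n"
  shows "vanishes_mod q g n"
proof -
  obtain w x where w: "x \<in> F n" "f n - g n = w + R (Suc n) x" "\<delta> w = 0" "n = 0 \<longrightarrow> x = 0"
    using aug_resolution_unique[OF assms(1,2)] by blast
  obtain x' y where x': "x' \<in> F n" "y \<in> F (Suc n)" "n = 0 \<longrightarrow> x' = 0"
      "\<delta> (f n) = \<delta> (R (Suc n) x') + of_nat q * R (Suc n) y"
    using assms(3) by (auto simp: vanishes_mod_def)
  have "g n = f n - (w + R (Suc n) x)"
    using w(2) by (simp add: algebra_simps)
  then have "\<delta> (g n) = \<delta> (f n) - \<delta> (R (Suc n) x)"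
    using w(3) by simp
  then have "\<delta> (g n) = \<delta> (R (Suc n) (x' - x)) + of_nat q * R (Suc n) y"
    using x'(4) by (simp add: algebra_simps)
  then show ?thesis
    unfolding vanishes_mod_def using w x' by (metis aug_cochains_diff diff_0_right)
qed

text \<open>The subcomplex that carries the \<open>n\<close>-th Smith class, the kernel of
  \<open>d\<close> or of \<open>s\<close> by parity. It is graded by dimension, hence
  \<open>F (Suc i)\<close>.\<close>

abbreviation Z :: "nat \<Rightarrow> nat \<Rightarrow> ('a list \<Rightarrow> int) set" where
  "Z n i \<equiv> {f \<in> F (Suc i). R n f = 0}"

lemma additive_complex_Z: "additive_complex (Z n) \<delta>"
  by unfold_locales
    (auto simp: additive.add[OF additive_coboundary] aug_cochains_zero aug_cochains_diff
      coboundary_closed res_op_coboundary)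

lemma smith_complex_eq: "smith_complex p K t n = (\<lambda>i. additive_group (Z n i))"
  by (rule ext) (simp add: smith_complex_def C_d_def C_s_def cochains_eq res_op_def)

lemma Z_eq: "Z n i = R (Suc n) ` F (Suc i)"
proof (intro equalityI subsetI)
  fix f assume f: "f \<in> Z n i"
  then have "R (Suc (Suc n)) f = 0" by (simp add: res_op_Suc_Suc)
  then show "f \<in> R (Suc n) ` F (Suc i)" using f kernel_res_op[of f "Suc i" "Suc n"] by blast
next
  fix f assume "f \<in> R (Suc n) ` F (Suc i)"
  then obtain x where "x \<in> F (Suc i)" "f = R (Suc n) x" by blast
  then show "f \<in> Z n i"
    using res_op_res_op[of x "Suc i" "Suc n"] by (simp add: res_op_closed res_op_Suc_Suc)
qed

text \<open>The recursion identifies the representative of the class with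
  \<open>\<delta> (f n)\<close>. This need not be a coboundary of the subcomplex, as
  \<open>f n\<close> itself need not lie in it.\<close>

lemma smith_class_eq:
  obtains f where "aug_resolution f"
    "\<And>n. smith_class p K t n = cohomology_class (smith_complex p K t n) (\<lambda>_. \<delta>) n (\<delta> (f n))"
proof -
  define \<phi> where "\<phi> = (SOME \<phi>. resolution p K t \<phi>)"
  obtain g where g: "aug_resolution g" using ex_aug_resolution by blast
  have "case_nat aug_unit (\<lambda>i. g (Suc i)) = g"
    using g by (auto simp: aug_resolution_def fun_eq_iff split: nat.split)
  then have "resolution p K t (\<lambda>i. g (Suc i))"
    using g by (simp add: resolution_iff)
  then have "resolution p K t \<phi>"
    unfolding \<phi>_def by (rule someI[of "resolution p K t"])
  then have *: "aug_resolution (case_nat aug_unit \<phi>)"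
    by (simp add: resolution_iff)
  have "smith_class p K t n = cohomology_class (smith_complex p K t n) (\<lambda>_. \<delta>) n
      (\<delta> (case_nat aug_unit \<phi> n))" for n
  proof -
    have "\<delta> (case_nat aug_unit \<phi> n) = R (Suc n) (\<phi> n)"
      using * by (auto simp: aug_resolution_def)
    then show ?thesis
      by (simp add: smith_class_def \<phi>_def[symmetric] Let_def res_op_def)
  qed
  then show thesis using that * by blast
qed

text \<open>For positive \<open>n\<close> the preceding group is the image of
  \<open>R (Suc n)\<close>; for \<open>n = 0\<close> there is none, which is the origin of the
  condition \<open>x = 0\<close>.\<close>

lemma coboundaries_Z:
  "additive_complex.B (Z n) \<delta> n = {\<delta> (R (Suc n) x) |x. x \<in> F n \<and> (n = 0 \<longrightarrow> x = 0)}"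
proof (cases n)
  case 0
  then show ?thesis
    using aug_cochains_zero[of K 0]
    by (auto simp: additive_complex.B_def[OF additive_complex_Z] intro!: exI[of _ 0])
next
  case (Suc j)
  then show ?thesis
    unfolding additive_complex.B_def[OF additive_complex_Z] by (auto simp: Z_eq)
qed

lemma smith_class_zero_mod_iff:
  assumes "aug_resolution f"
  shows "smith_class_zero_mod q p K t n \<longleftrightarrow> vanishes_mod q f n"
proof -
  interpret Z: additive_complex "Z n" \<delta> by (rule additive_complex_Z)
  obtain g where g: "aug_resolution g"
    "smith_class p K t n = cohomology_class (smith_complex p K t n) (\<lambda>_. \<delta>) n (\<delta> (g n))"
    using smith_class_eq by metis
  have "smith_class_zero_mod q p K t n \<longleftrightarrow>
      (\<exists>b\<in>Z.B n. \<exists>y\<in>Z n n. \<delta> (g n) = b + of_nat q * y)"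
    unfolding smith_class_zero_mod_def Let_def g(2) unfolding smith_complex_eq
    by (rule Z.reduction_zero_iff)
  also have "\<dots> \<longleftrightarrow> vanishes_mod q g n"
    unfolding coboundaries_Z unfolding Z_eq vanishes_mod_def by blast
  also have "\<dots> \<longleftrightarrow> vanishes_mod q f n"
    using vanishes_mod_independent assms g(1) by blast
  finally show ?thesis .
qed

lemma smith_class_zeroI:
  assumes "aug_resolution f" "vanishes_mod 0 f n"
  shows "smith_class_zero p K t n"
proof -
  interpret Z: additive_complex "Z n" \<delta> by (rule additive_complex_Z)
  obtain g where g: "aug_resolution g"
    "smith_class p K t n = cohomology_class (smith_complex p K t n) (\<lambda>_. \<delta>) n (\<delta> (g n))"
    using smith_class_eq by metis
  have "vanishes_mod 0 g n"
    using vanishes_mod_independent assms g(1) by blast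
  then have "\<delta> (g n) \<in> Z.B n"
    unfolding coboundaries_Z by (auto simp: vanishes_mod_def)
  then show ?thesis
    unfolding smith_class_zero_def g(2) unfolding smith_complex_eq
    by (rule Z.class_zero)
qed

lemma aug_cochains_trivial:
  assumes "m > card (\<Union>K)"
  shows "F m = {0}"
proof -
  have fin: "finite (\<Union>K)"
    using complex by (auto simp: simplicial_complex_def)
  have "f = 0" if f: "f \<in> F m" for f
  proof
    fix xs
    have "length xs \<le> card (\<Union>K)" if "distinct xs" "set xs \<in> K"
      using that card_mono[OF fin, of "set xs"] by (auto simp: distinct_card)
    then show "f xs = 0 xs"
      using aug_cochains_support[OF f, of xs] assms by (force simp: pointwise)
  qed
  then show ?thesis using aug_cochains_zero by blast
qed

text \<open>Above the number of vertices all cochains are zero, so the minimum in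
  \<open>smith_index_mod\<close> is attained.\<close>

lemma ex_smith_class_zero_mod: "\<exists>n. smith_class_zero_mod q p K t n"
proof -
  obtain f where f: "aug_resolution f" using ex_aug_resolution by blast
  let ?n = "Suc (card (\<Union>K))"
  have "\<delta> (f ?n) \<in> F (Suc ?n)"
    using f by (intro coboundary_closed) (simp add: aug_resolution_def)
  then have "\<delta> (f ?n) = 0"
    by (simp add: aug_cochains_trivial)
  then have "vanishes_mod q f ?n"
    unfolding vanishes_mod_def
    by (intro bexI[of _ 0]) (simp_all add: aug_cochains_zero)
  then show ?thesis
    using smith_class_zero_mod_iff[OF f] by blast
qed

end


section \<open>Products on the join\<close>

fun lefts :: "('a + 'b) list \<Rightarrow> 'a list" where
  "lefts [] = []" |
  "lefts (Inl a # zs) = a # lefts zs" |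
  "lefts (Inr b # zs) = lefts zs"

fun rights :: "('a + 'b) list \<Rightarrow> 'b list" where
  "rights [] = []" |
  "rights (Inl a # zs) = rights zs" |
  "rights (Inr b # zs) = b # rights zs"

text \<open>The sign of the shuffle that moves the vertices of the first factor to the front: each
  \<open>Inr\<close> passes every later \<open>Inl\<close>.\<close>

fun shuffle_sign :: "('a + 'b) list \<Rightarrow> int" where
  "shuffle_sign [] = 1" |
  "shuffle_sign (Inl a # zs) = shuffle_sign zs" |
  "shuffle_sign (Inr b # zs) = (- 1) ^ length (lefts zs) * shuffle_sign zs"

text \<open>The cross product of cochains: the plain product on lists with the first factor in
  front, extended to all orderings by the shuffle sign.\<close>

definition join_prod :: "('a list \<Rightarrow> int) \<Rightarrow> ('b list \<Rightarrow> int) \<Rightarrow> ('a + 'b) list \<Rightarrow> int" where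
  "join_prod f g zs = shuffle_sign zs * f (lefts zs) * g (rights zs)"

lemma lefts_append: "lefts (xs @ ys) = lefts xs @ lefts ys"
  by (induction xs rule: lefts.induct) auto

lemma rights_append: "rights (xs @ ys) = rights xs @ rights ys"
  by (induction xs rule: rights.induct) auto

lemma shuffle_sign_append:
  "shuffle_sign (xs @ ys) =
     shuffle_sign xs * (- 1) ^ (length (rights xs) * length (lefts ys)) * shuffle_sign ys"
  by (induction xs rule: shuffle_sign.induct) (auto simp: lefts_append power_add)

lemma set_lefts_rights: "set zs = set (lefts zs) <+> set (rights zs)"
  by (induction zs rule: lefts.induct) auto

lemma distinct_lefts_rights: "distinct zs \<longleftrightarrow> distinct (lefts zs) \<and> distinct (rights zs)"
  by (induction zs rule: lefts.induct) (auto simp: set_lefts_rights)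

lemma length_lefts_rights: "length zs = length (lefts zs) + length (rights zs)"
  by (induction zs rule: lefts.induct) auto

lemma lefts_map_sum: "lefts (map (map_sum f g) zs) = map f (lefts zs)"
  by (induction zs rule: lefts.induct) auto

lemma rights_map_sum: "rights (map (map_sum f g) zs) = map g (rights zs)"
  by (induction zs rule: lefts.induct) auto

lemma shuffle_sign_map_sum: "shuffle_sign (map (map_sum f g) zs) = shuffle_sign zs"
  by (induction zs rule: lefts.induct) (auto simp: lefts_map_sum)

lemma Plus_eq_iff: "A <+> B = C <+> D \<longleftrightarrow> A = C \<and> B = D"
  by (auto simp: Plus_def)

lemma Plus_in_join: "\<sigma> <+> \<tau> \<in> simplicial_join K L \<longleftrightarrow> \<sigma> \<in> K \<and> \<tau> \<in> L"
  by (auto simp: simplicial_join_def Plus_eq_iff)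

lemma set_in_join:
  "set zs \<in> simplicial_join K L \<longleftrightarrow> set (lefts zs) \<in> K \<and> set (rights zs) \<in> L"
  by (subst set_lefts_rights) (rule Plus_in_join)

lemma additive_join_prod_left: "additive (\<lambda>f. join_prod f g)"
  by unfold_locales (simp add: fun_eq_iff join_prod_def pointwise algebra_simps)

lemma additive_join_prod_right: "additive (join_prod f)"
  by unfold_locales (simp add: fun_eq_iff join_prod_def pointwise algebra_simps)

lemmas join_prod_additive =
  additive.add[OF additive_join_prod_left] additive.diff[OF additive_join_prod_left]
  additive.zero[OF additive_join_prod_left] additive.minus[OF additive_join_prod_left]
  additive.add[OF additive_join_prod_right] additive.diff[OF additive_join_prod_right]
  additive.zero[OF additive_join_prod_right] additive.minus[OF additive_join_prod_right]

text \<open>Faces are shorter by one, which accounts for the extra sign. It is needed when an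
  \<open>Inr\<close> at the head contributes a sign depending on the number of left entries.\<close>

lemma face_sum_alternating_sign:
  "face_sum (\<lambda>ys. (- 1) ^ length ys * f ys) xs = - ((- 1) ^ length xs * face_sum f xs)"
proof -
  have "face_sum (\<lambda>ys. (- 1) ^ length ys * f ys) xs =
      face_sum (\<lambda>ys. - ((- 1) ^ length xs) * f ys) xs"
    by (rule face_sum_cong) simp
  also have "\<dots> = - ((- 1) ^ length xs) * face_sum f xs"
    by (rule face_sum_scale)
  finally show ?thesis by simp
qed

text \<open>The Leibniz rule. In the induction a head from the first factor is absorbed into
  \<open>f\<close>; one from the second is absorbed into \<open>g\<close> and multiplies
  \<open>f\<close> by the sign of the length.\<close>

lemma face_sum_join_prod:
  "face_sum (join_prod f g) zs =
     join_prod (face_sum f) g zs + (- 1) ^ length (lefts zs) * join_prod f (face_sum g) zs"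
proof (induction zs arbitrary: f g rule: lefts.induct)
  case 1
  show ?case by (simp add: join_prod_def)
next
  case (2 a zs)
  have "(\<lambda>ys. join_prod f g (Inl a # ys)) = join_prod (\<lambda>xs. f (a # xs)) g"
    by (simp add: fun_eq_iff join_prod_def)
  then have "face_sum (join_prod f g) (Inl a # zs) =
      join_prod f g zs - face_sum (join_prod (\<lambda>xs. f (a # xs)) g) zs"
    by simp
  then show ?case
    unfolding 2 by (simp add: join_prod_def algebra_simps)
next
  case (3 b zs)
  have "(\<lambda>ys. join_prod f g (Inr b # ys)) =
      join_prod (\<lambda>xs. (- 1) ^ length xs * f xs) (\<lambda>xs. g (b # xs))"
    by (simp add: fun_eq_iff join_prod_def)
  then have "face_sum (join_prod f g) (Inr b # zs) = join_prod f g zs -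
      face_sum (join_prod (\<lambda>xs. (- 1) ^ length xs * f xs) (\<lambda>xs. g (b # xs))) zs"
    by simp
  also have "face_sum (join_prod (\<lambda>xs. (- 1) ^ length xs * f xs) (\<lambda>xs. g (b # xs))) zs =
      - (shuffle_sign zs * ((- 1) ^ length (lefts zs) * face_sum f (lefts zs)) * g (b # rights zs)) +
      (- 1) ^ length (lefts zs) * (shuffle_sign zs * ((- 1) ^ length (lefts zs) * f (lefts zs)) *
        face_sum (\<lambda>xs. g (b # xs)) (rights zs))"
    by (simp only: 3 join_prod_def face_sum_alternating_sign) simp
  finally show ?case
    by (cases "even (length (lefts zs))") (simp_all add: join_prod_def algebra_simps)
qed

lemma join_prod_closed:
  assumes f: "f \<in> aug_cochains K m" and g: "g \<in> aug_cochains L n"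
  shows "join_prod f g \<in> aug_cochains (simplicial_join K L) (m + n)"
proof -
  have "join_prod f g (as @ x # y # bs) = - join_prod f g (as @ y # x # bs)" for as x y bs
    \<comment> \<open>Exchanging vertices of different factors changes only the shuffle sign; within
      one factor, \<open>f\<close> or \<open>g\<close> changes sign.\<close>
    using alternatingD[OF aug_cochains_alternating[OF f], of "lefts as" "projl x" "projl y" "lefts bs"]
      alternatingD[OF aug_cochains_alternating[OF g], of "rights as" "projr x" "projr y" "rights bs"]
    by (cases x; cases y)
      (simp_all add: join_prod_def shuffle_sign_append lefts_append rights_append)
  then have "alternating (join_prod f g)"
    unfolding alternating_def by blast
  moreover have "length zs = m + n \<and> distinct zs \<and> set zs \<in> simplicial_join K L"
    if "join_prod f g zs \<noteq> 0" for zs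
    using that aug_cochains_support[OF f, of "lefts zs"] aug_cochains_support[OF g, of "rights zs"]
    by (simp add: join_prod_def set_in_join distinct_lefts_rights[of zs] length_lefts_rights[of zs])
  ultimately show ?thesis by (simp add: aug_cochains_def)
qed

lemma coboundary_join_prod:
  assumes f: "f \<in> aug_cochains K m" and g: "g \<in> aug_cochains L n"
  shows "coboundary (simplicial_join K L) (join_prod f g) = join_prod (coboundary K f) g +
    (if even m then join_prod f (coboundary L g) else - join_prod f (coboundary L g))"
proof
  fix zs
  \<comment> \<open>On the support of \<open>f\<close> the length is \<open>m\<close>, so the sign
    in the Leibniz rule depends only on \<open>m\<close>.\<close>
  have sign: "(- 1) ^ length xs * (c * f xs * e) =
      (if even m then c * f xs * e else - (c * f xs * e))" for c e xs
    using aug_cochains_support[OF f, of xs] by (cases "f xs = 0") auto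
  show "coboundary (simplicial_join K L) (join_prod f g) zs = (join_prod (coboundary K f) g +
    (if even m then join_prod f (coboundary L g) else - join_prod f (coboundary L g))) zs"
    using aug_cochains_support[OF f, of "lefts zs"] aug_cochains_support[OF g, of "rights zs"]
    by (auto simp: coboundary_eq face_sum_join_prod join_prod_def pointwise set_in_join sign
        distinct_lefts_rights[of zs])
qed

lemma t_op_join_prod:
  "t_op (simplicial_join K L) (map_sum t u) (join_prod f g) = join_prod (t_op K t f) (t_op L u g)"
  by (auto simp: fun_eq_iff t_op_def join_prod_def set_in_join lefts_map_sum rights_map_sum
      shuffle_sign_map_sum)

lemma t_op_funpow_join_prod:
  "(t_op (simplicial_join K L) (map_sum t u) ^^ k) (join_prod f g) =
     join_prod ((t_op K t ^^ k) f) ((t_op L u ^^ k) g)"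
  by (induction k) (simp_all add: t_op_join_prod)

lemma join_prod_aug_unit: "join_prod aug_unit aug_unit = aug_unit"
proof
  fix zs :: "('a + 'b) list"
  show "join_prod aug_unit aug_unit zs = aug_unit zs"
    by (cases zs rule: lefts.cases)
      (auto simp: join_prod_def aug_unit_def)
qed

section \<open>The join as a complex with free action\<close>

lemma Union_join:
  assumes "{} \<in> K" "{} \<in> L"
  shows "\<Union> (simplicial_join K L) = \<Union>K <+> \<Union>L"
proof (intro equalityI subsetI)
  fix z assume z: "z \<in> \<Union>K <+> \<Union>L"
  then consider (left) a \<sigma> where "z = Inl a" "a \<in> \<sigma>" "\<sigma> \<in> K"
    | (right) b \<tau> where "z = Inr b" "b \<in> \<tau>" "\<tau> \<in> L"
    by (auto simp: Plus_def)
  then show "z \<in> \<Union> (simplicial_join K L)"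
  proof cases
    case left
    then have "z \<in> \<sigma> <+> {}" "\<sigma> <+> {} \<in> simplicial_join K L"
      using assms by (auto simp: Plus_in_join)
    then show ?thesis by (rule UnionI[rotated])
  next
    case right
    then have "z \<in> {} <+> \<tau>" "{} <+> \<tau> \<in> simplicial_join K L"
      using assms by (auto simp: Plus_in_join)
    then show ?thesis by (rule UnionI[rotated])
  qed
qed (auto simp: simplicial_join_def)

lemma map_sum_image_Plus: "map_sum f g ` (A <+> B) = f ` A <+> g ` B"
  by (force simp: Plus_def)

lemma map_sum_funpow:
  fixes f :: "'a \<Rightarrow> 'a" and g :: "'b \<Rightarrow> 'b"
  shows "map_sum f g ^^ k = map_sum (f ^^ k) (g ^^ k)"
proof (induction k)
  case 0
  show ?case unfolding funpow.simps by (rule map_sum.id[symmetric])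
next
  case (Suc k)
  show ?case unfolding funpow.simps Suc by (rule map_sum.comp)
qed

lemma Plus_decompose: "X = {a. Inl a \<in> X} <+> {b. Inr b \<in> X}"
proof (intro equalityI subsetI)
  fix z assume "z \<in> X"
  then show "z \<in> {a. Inl a \<in> X} <+> {b. Inr b \<in> X}"
    by (cases z) auto
qed auto

lemma simplicial_complex_join:
  assumes "simplicial_complex K" "simplicial_complex L"
  shows "simplicial_complex (simplicial_join K L)"
proof -
  have "simplicial_join K L = (\<lambda>(\<sigma>, \<tau>). \<sigma> <+> \<tau>) ` (K \<times> L)"
    by (auto simp: simplicial_join_def)
  then have "finite (simplicial_join K L)"
    using assms by (simp add: simplicial_complex_def)
  moreover have "{} \<in> simplicial_join K L"
    using assms Plus_in_join[of "{}" "{}" K L] by (simp add: simplicial_complex_def Plus_def)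
  moreover have "\<forall>\<sigma>\<in>simplicial_join K L. finite \<sigma>"
    using assms by (auto simp: simplicial_join_def simplicial_complex_def)
  moreover have "\<tau> \<in> simplicial_join K L" if "\<sigma> \<in> simplicial_join K L" "\<tau> \<subseteq> \<sigma>" for \<sigma> \<tau>
  proof -
    obtain \<alpha> \<beta> where *: "\<sigma> = \<alpha> <+> \<beta>" "\<alpha> \<in> K" "\<beta> \<in> L"
      using \<open>\<sigma> \<in> simplicial_join K L\<close> by (auto simp: simplicial_join_def)
    have "{a. Inl a \<in> \<tau>} \<subseteq> \<alpha>" "{b. Inr b \<in> \<tau>} \<subseteq> \<beta>"
      using that(2) * by auto
    then have "{a. Inl a \<in> \<tau>} <+> {b. Inr b \<in> \<tau>} \<in> simplicial_join K L"
      using assms * unfolding Plus_in_join simplicial_complex_def by blast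
    then show ?thesis using Plus_decompose[of \<tau>] by simp
  qed
  ultimately show ?thesis by (auto simp: simplicial_complex_def)
qed

lemma simplicial_automorphism_join:
  assumes "simplicial_complex K" "simplicial_complex L"
    and t: "simplicial_automorphism K t" and u: "simplicial_automorphism L u"
  shows "simplicial_automorphism (simplicial_join K L) (map_sum t u)"
proof -
  have U: "\<Union> (simplicial_join K L) = \<Union>K <+> \<Union>L"
    using assms by (intro Union_join) (auto simp: simplicial_complex_def)
  have "inj_on (map_sum t u) (\<Union>K <+> \<Union>L)"
    using t u by (auto simp: simplicial_automorphism_def bij_betw_def inj_on_def)
  moreover have "map_sum t u ` (\<Union>K <+> \<Union>L) = \<Union>K <+> \<Union>L"
    using t u by (simp add: map_sum_image_Plus simplicial_automorphism_def bij_betw_def)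
  ultimately have bij: "bij_betw (map_sum t u) (\<Union>K <+> \<Union>L) (\<Union>K <+> \<Union>L)"
    by (simp add: bij_betw_def)
  have "map_sum t u ` X \<in> simplicial_join K L \<longleftrightarrow> X \<in> simplicial_join K L"
    if "X \<subseteq> \<Union>K <+> \<Union>L" for X
  proof -
    have "{a. Inl a \<in> X} \<subseteq> \<Union>K" "{b. Inr b \<in> X} \<subseteq> \<Union>L"
      using that by auto
    then have "map_sum t u ` ({a. Inl a \<in> X} <+> {b. Inr b \<in> X}) \<in> simplicial_join K L \<longleftrightarrow>
        {a. Inl a \<in> X} <+> {b. Inr b \<in> X} \<in> simplicial_join K L"
      using t u by (simp add: map_sum_image_Plus Plus_in_join simplicial_automorphism_def)
    then show ?thesis using Plus_decompose[of X] by simp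
  qed
  with bij show ?thesis by (simp add: simplicial_automorphism_def U)
qed

text \<open>A simplex of the join that is fixed has both parts fixed, and one part is non-empty, so
  freeness passes from the factors to the join.\<close>

lemma Zp_complex_join:
  assumes K: "Zp_complex p K t" and L: "Zp_complex p L u"
  shows "Zp_complex p (simplicial_join K L) (map_sum t u)"
proof -
  have complexes: "simplicial_complex K" "simplicial_complex L"
    using assms by (auto simp: Zp_complex_def)
  have U: "\<Union> (simplicial_join K L) = \<Union>K <+> \<Union>L"
    using complexes by (intro Union_join) (auto simp: simplicial_complex_def)
  have "\<forall>v\<in>\<Union> (simplicial_join K L). (map_sum t u ^^ p) v = v"
    using assms unfolding U map_sum_funpow by (auto simp: Zp_complex_def)
  moreover have "(map_sum t u ^^ k) ` X \<noteq> X"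
    if X: "X \<in> simplicial_join K L" "X \<noteq> {}" and k: "\<not> p dvd k" for X k
  proof
    assume eq: "(map_sum t u ^^ k) ` X = X"
    obtain \<alpha> \<beta> where *: "X = \<alpha> <+> \<beta>" "\<alpha> \<in> K" "\<beta> \<in> L"
      using X by (auto simp: simplicial_join_def)
    then have "(t ^^ k) ` \<alpha> = \<alpha>" "(u ^^ k) ` \<beta> = \<beta>"
      using eq by (auto simp: map_sum_funpow map_sum_image_Plus Plus_eq_iff)
    moreover have "\<alpha> \<noteq> {} \<or> \<beta> \<noteq> {}"
      using X * by auto
    moreover have "\<alpha> \<noteq> {} \<Longrightarrow> (t ^^ k) ` \<alpha> \<noteq> \<alpha>" "\<beta> \<noteq> {} \<Longrightarrow> (u ^^ k) ` \<beta> \<noteq> \<beta>"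
      using K L k * by (simp_all add: Zp_complex_def)
    ultimately show False by blast
  qed
  ultimately show ?thesis
    using assms complexes by (auto simp: Zp_complex_def simplicial_complex_join
        simplicial_automorphism_join)
qed

section \<open>The diagonal term and its identities\<close>

lemma sum_triangle_shift:
  fixes c :: "nat \<Rightarrow> nat \<Rightarrow> 'c::ab_group_add"
  shows "(\<Sum>z<n. \<Sum>y<z. c y z - c (Suc y) (Suc z)) =
    (\<Sum>z<n. c 0 z) - c 0 0 - (\<Sum>y<n. c y n) + c 0 n"
proof (induction n)
  case (Suc n)
  have "(\<Sum>y<Suc n. c y (Suc n)) = c 0 (Suc n) + (\<Sum>y<n. c (Suc y) (Suc n))"
    by (rule sum.lessThan_Suc_shift)
  then show ?case
    using Suc by (simp add: sum_subtractf algebra_simps del: sum.lessThan_Suc)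
      (simp add: algebra_simps)
qed simp

locale zp_join = K: zp_complex p K t + L: zp_complex p L u
  for p :: nat and K :: "'a set set" and t :: "'a \<Rightarrow> 'a"
    and L :: "'b set set" and u :: "'b \<Rightarrow> 'b"

sublocale zp_join \<subseteq> J: zp_complex p "simplicial_join K L" "map_sum t u"
  by unfold_locales (auto intro: Zp_complex_join K.zp L.zp K.p_pos)

context zp_join
begin

notation join_prod (infixl \<open>\<star>\<close> 70)

text \<open>The operator - \<Sum> t^y \<otimes> u^z over 0 \<le> y < z < p, which appears in the
  classical diagonal approximation for cyclic groups; the sign fits
  \<open>d_op_diagonal\<close>.\<close>

definition diagonal :: "('a list \<Rightarrow> int) \<Rightarrow> ('b list \<Rightarrow> int) \<Rightarrow> ('a + 'b) list \<Rightarrow> int" where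
  "diagonal f g = - (\<Sum>z<p. (\<Sum>y<z. (K.T ^^ y) f) \<star> (L.T ^^ z) g)"

lemma diagonal_closed:
  "f \<in> K.F m \<Longrightarrow> g \<in> L.F n \<Longrightarrow> diagonal f g \<in> J.F (m + n)"
  unfolding diagonal_def
  by (intro aug_cochains_uminus aug_cochains_sum join_prod_closed K.t_op_funpow_closed
      L.t_op_funpow_closed)

lemma join_prod_sum_left: "(\<Sum>i\<in>A. f i) \<star> g = (\<Sum>i\<in>A. f i \<star> g)"
  by (rule additive.sum[OF additive_join_prod_left])

lemma join_prod_sum_right: "f \<star> (\<Sum>i\<in>A. g i) = (\<Sum>i\<in>A. f \<star> g i)"
  by (rule additive.sum[OF additive_join_prod_right])

lemma d_op_diagonal:
  assumes f: "f \<in> K.F m" and g: "g \<in> L.F n"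
  shows "J.d (diagonal f g) = K.s f \<star> g - f \<star> L.s g"
proof -
  define c where "c = (\<lambda>y z. (K.T ^^ y) f \<star> (L.T ^^ z) g)"
  have c: "(K.T ^^ y) f \<star> (L.T ^^ z) g = c y z" for y z
    by (simp add: c_def)
  have "J.d (c y z) = c y z - c (Suc y) (Suc z)" for y z
    by (simp add: c_def d_op_def t_op_join_prod)
  then have "J.d (diagonal f g) = - (\<Sum>z<p. \<Sum>y<z. c y z - c (Suc y) (Suc z))"
    by (simp only: diagonal_def join_prod_sum_left c operators_additive)
  \<comment> \<open>The diagonal action raises both exponents, so the sum over the triangle
    telescopes to the edges \<open>y = 0\<close> and \<open>z = p\<close>. As u^p fixes
    \<open>g\<close>, the exponent \<open>p\<close> becomes 0 below and the corner terms
    cancel.\<close>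
  also have "\<dots> = (\<Sum>y<p. c y p) - (\<Sum>z<p. c 0 z) + c 0 0 - c 0 p"
    unfolding sum_triangle_shift by simp
  finally have "J.d (diagonal f g) = (\<Sum>y<p. c y p) - (\<Sum>z<p. c 0 z) + c 0 0 - c 0 p" .
  moreover have "c y p = c y 0" for y
    by (simp add: c_def L.t_op_funpow_p[OF g])
  moreover have "(\<Sum>y<p. c y 0) = K.s f \<star> g"
    by (simp add: c_def s_op_def join_prod_sum_left)
  moreover have "(\<Sum>z<p. c 0 z) = f \<star> L.s g"
    by (simp add: c_def s_op_def join_prod_sum_right)
  ultimately show ?thesis by simp
qed

text \<open>The inner geometric sum times 1 - t is 1 - t^z; summed over \<open>z\<close>, the powers
  acting on both factors form the norm of the join.\<close>

lemma diagonal_d_op_left: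
  "diagonal (K.d f) g = J.s (f \<star> g) - f \<star> L.s g"
proof -
  have "(K.T ^^ y) (K.d f) = K.d ((K.T ^^ y) f)" for y
    by (simp add: d_op_def funpow_swap1)
  then have "(\<Sum>y<z. (K.T ^^ y) (K.d f)) = f - (K.T ^^ z) f" for z
    by (simp only: additive.sum[OF additive_d_op, symmetric] d_op_geometric_sum)
  then have "diagonal (K.d f) g = - (\<Sum>z<p. f \<star> (L.T ^^ z) g - (K.T ^^ z) f \<star> (L.T ^^ z) g)"
    by (simp only: diagonal_def join_prod_additive)
  then show ?thesis
    by (simp add: sum_subtractf s_op_def join_prod_sum_right t_op_funpow_join_prod)
qed

text \<open>Summation by parts in \<open>z\<close>: the partial sums over \<open>y\<close> differ by
  single powers, now paired with \<open>L.T g\<close>, and the boundary term at \<open>p\<close>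
  contributes \<open>K.s f\<close> times \<open>g\<close>.\<close>

lemma diagonal_d_op_right:
  assumes g: "g \<in> L.F n"
  shows "diagonal f (L.d g) = K.s f \<star> g - J.s (f \<star> L.T g)"
proof -
  define c where "c = (\<lambda>z. \<Sum>y<z. (K.T ^^ y) f)"
  have step: "(L.T ^^ z) (L.d g) = (L.T ^^ z) g - (L.T ^^ Suc z) g" for z
    by (simp add: d_op_def funpow_swap1)
  have "(\<Sum>z<k. c z \<star> (L.T ^^ z) (L.d g)) =
      (\<Sum>z<k. (K.T ^^ z) f \<star> (L.T ^^ Suc z) g) - c k \<star> (L.T ^^ k) g" for k
  proof (induction k)
    case 0
    show ?case by (simp add: c_def join_prod_additive)
  next
    case (Suc k)
    have "c (Suc k) = c k + (K.T ^^ k) f" by (simp add: c_def)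
    then show ?case
      using Suc by (simp add: step join_prod_additive del: funpow.simps)
  qed
  from this[of p] show ?thesis
    unfolding diagonal_def c_def[symmetric]
    by (simp add: L.t_op_funpow_p[OF g] s_op_def t_op_funpow_join_prod funpow_swap1 c_def)
qed

lemma coboundary_diagonal:
  assumes f: "f \<in> K.F m" and g: "g \<in> L.F n" and "odd m"
  shows "J.\<delta> (diagonal f g) = diagonal (K.\<delta> f) g - diagonal f (L.\<delta> g)"
proof -
  have "J.\<delta> ((\<Sum>y<z. (K.T ^^ y) f) \<star> (L.T ^^ z) g) =
      (\<Sum>y<z. (K.T ^^ y) (K.\<delta> f)) \<star> (L.T ^^ z) g -
      (\<Sum>y<z. (K.T ^^ y) f) \<star> (L.T ^^ z) (L.\<delta> g)" for z
  proof -
    have "(\<Sum>y<z. (K.T ^^ y) f) \<in> K.F m"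
      by (intro aug_cochains_sum K.t_op_funpow_closed f)
    from coboundary_join_prod[OF this L.t_op_funpow_closed[OF g]] show ?thesis
      using \<open>odd m\<close> by (simp add: K.t_op_funpow_coboundary L.t_op_funpow_coboundary)
  qed
  then show ?thesis
    by (simp add: diagonal_def sum_subtractf)
qed

text \<open>
  The product of two resolutions. It is the diagonal approximation of the standard resolution of
  a cyclic group, with the parities exchanged by the shift of degrees. The coboundary of the term
  of bidegree \<open>(i, j)\<close> splits into the terms \<open>left_part\<close> of bidegree \<open>(i + 1, j)\<close> and
  \<open>right_part\<close> of bidegree \<open>(i, j + 1)\<close>.
\<close>

context
  fixes f :: "nat \<Rightarrow> 'a list \<Rightarrow> int" and g :: "nat \<Rightarrow> 'b list \<Rightarrow> int"
  assumes f: "K.aug_resolution f" and g: "L.aug_resolution g"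
begin

definition bidegree_part :: "nat \<Rightarrow> nat \<Rightarrow> ('a + 'b) list \<Rightarrow> int" where
  "bidegree_part i j = (if even i then f i \<star> g j
     else if even j then f i \<star> L.T (g j) else diagonal (f i) (g j))"

definition left_part :: "nat \<Rightarrow> nat \<Rightarrow> ('a + 'b) list \<Rightarrow> int" where
  "left_part i j = (if odd i then K.s (f i) \<star> g j
     else if even j then K.d (f i) \<star> L.T (g j) else J.s (f i \<star> g j) - f i \<star> L.s (g j))"

definition right_part :: "nat \<Rightarrow> nat \<Rightarrow> ('a + 'b) list \<Rightarrow> int" where
  "right_part i j = (if even i then (if even j then f i \<star> L.d (g j) else f i \<star> L.s (g j))
     else if even j then J.s (f i \<star> L.T (g j)) - K.s (f i) \<star> g j else - (f i \<star> L.s (g j)))"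

definition resolution_prod :: "nat \<Rightarrow> ('a + 'b) list \<Rightarrow> int" where
  "resolution_prod k = (\<Sum>i\<le>k. bidegree_part i (k - i))"

lemma f_closed: "f i \<in> K.F i" and g_closed: "g j \<in> L.F j"
  using f g by (auto simp: K.aug_resolution_def L.aug_resolution_def)

lemma coboundary_f: "K.\<delta> (f i) = K.R (Suc i) (f (Suc i))"
  and coboundary_g: "L.\<delta> (g j) = L.R (Suc j) (g (Suc j))"
  using f g by (auto simp: K.aug_resolution_def L.aug_resolution_def)

lemma f_0: "f 0 = aug_unit" and g_0: "g 0 = aug_unit"
  using f g by (auto simp: K.aug_resolution_def L.aug_resolution_def)

lemma bidegree_part_closed: "bidegree_part i j \<in> J.F (i + j)"
  by (auto simp: bidegree_part_def intro!: join_prod_closed diagonal_closed f_closed g_closed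
      L.t_op_closed)

text \<open>For odd \<open>i\<close> more than the Leibniz rule is needed: if \<open>j\<close> is
  even, the twist by \<open>L.T\<close> is absorbed by \<open>L.s\<close>, and if \<open>j\<close>
  is odd, the identities for \<open>diagonal\<close> on images of \<open>d\<close> enter.\<close>

lemma coboundary_bidegree_part:
  "J.\<delta> (bidegree_part i j) = left_part (Suc i) j + right_part i (Suc j)"
proof (cases "even i")
  case True
  then show ?thesis
    by (auto simp: bidegree_part_def left_part_def right_part_def res_op_def
        coboundary_join_prod[OF f_closed g_closed] coboundary_f coboundary_g)
next
  case odd_i: False
  show ?thesis
  proof (cases "even j")
    case True
    have "L.\<delta> (L.T (g j)) = L.s (g (Suc j))"
      using True coboundary_g[of j] L.t_op_s_op[OF g_closed[of "Suc j"]]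
      by (simp add: L.t_op_coboundary[symmetric] res_op_def)
    then show ?thesis
      using True odd_i
      by (simp add: bidegree_part_def left_part_def right_part_def res_op_def
          coboundary_join_prod[OF f_closed L.t_op_closed[OF g_closed]] coboundary_f)
  next
    case False
    then show ?thesis
      using odd_i
      by (simp add: bidegree_part_def left_part_def right_part_def res_op_def
          coboundary_diagonal[OF f_closed g_closed] coboundary_f coboundary_g diagonal_d_op_left
          diagonal_d_op_right[OF g_closed])
  qed
qed

text \<open>If exactly one index is odd, the correction terms of the two parts cancel. If both are
  even, 1 - t\<otimes>u = (1 - t)\<otimes>u + 1\<otimes>(1 - u) applies; if both are odd,
  \<open>d_op_diagonal\<close>.\<close>

lemma left_part_plus_right_part:
  "left_part i j + right_part i j = J.R (i + j) (bidegree_part i j)"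
proof -
  have "J.d (f i \<star> g j) = K.d (f i) \<star> L.T (g j) + f i \<star> L.d (g j)"
    by (simp add: d_op_def t_op_join_prod join_prod_additive)
  then show ?thesis
    by (auto simp: left_part_def right_part_def bidegree_part_def res_op_def
        d_op_diagonal[OF f_closed g_closed])
qed

lemma s_op_join_prod_invariant_left: "K.T f' = f' \<Longrightarrow> J.s (f' \<star> g') = f' \<star> L.s g'"
proof -
  assume "K.T f' = f'"
  then have "(K.T ^^ k) f' = f'" for k by (induction k) auto
  then show ?thesis by (simp add: s_op_def t_op_funpow_join_prod join_prod_sum_right)
qed

lemma s_op_join_prod_invariant_right: "L.T g' = g' \<Longrightarrow> J.s (f' \<star> g') = K.s f' \<star> g'"
proof -
  assume "L.T g' = g'"
  then have "(L.T ^^ k) g' = g'" for k by (induction k) auto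
  then show ?thesis by (simp add: s_op_def t_op_funpow_join_prod join_prod_sum_left)
qed

text \<open>The augmentation is invariant: \<open>d\<close> kills it, and the norm of a product with
  it acts on the other factor alone. This removes an edge term that has no counterpart in a
  coboundary.\<close>

lemma left_part_0: "left_part 0 j = 0"
  by (simp add: left_part_def f_0 d_op_def K.t_op_aug_unit join_prod_additive
      s_op_join_prod_invariant_left)

lemma right_part_0: "right_part i 0 = 0"
  by (simp add: right_part_def g_0 d_op_def L.t_op_aug_unit join_prod_additive
      s_op_join_prod_invariant_right)

lemma aug_resolution_prod: "J.aug_resolution resolution_prod"
  unfolding J.aug_resolution_def
proof (intro conjI allI)
  show "resolution_prod 0 = aug_unit"
    by (simp add: resolution_prod_def bidegree_part_def f_0 g_0 join_prod_aug_unit)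
next
  fix k
  have "bidegree_part i (k - i) \<in> J.F k" if "i \<le> k" for i
    using bidegree_part_closed[of i "k - i"] that by simp
  then show "resolution_prod k \<in> J.F k"
    unfolding resolution_prod_def by (intro aug_cochains_sum) auto
next
  fix k
  have "J.R (Suc k) (resolution_prod (Suc k)) =
      (\<Sum>i\<le>Suc k. J.R (Suc k) (bidegree_part i (Suc k - i)))"
    unfolding resolution_prod_def by (rule additive.sum[OF additive_res_op])
  also have "\<dots> = (\<Sum>i\<le>Suc k. left_part i (Suc k - i) + right_part i (Suc k - i))"
    by (rule sum.cong) (simp_all add: left_part_plus_right_part)
  \<comment> \<open>The edge terms \<open>left_part 0 (Suc k)\<close> and
    \<open>right_part (Suc k) 0\<close> vanish; the rest matches the coboundaries of the terms of
    total degree \<open>k\<close>.\<close>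
  also have "\<dots> = (\<Sum>i\<le>k. left_part (Suc i) (k - i)) + (\<Sum>i\<le>k. right_part i (Suc k - i))"
    unfolding sum.distrib
    by (subst sum.atMost_Suc_shift) (simp add: left_part_0 right_part_0)
  also have "(\<Sum>i\<le>k. right_part i (Suc k - i)) = (\<Sum>i\<le>k. right_part i (Suc (k - i)))"
    by (rule sum.cong) (simp_all add: Suc_diff_le)
  also have "(\<Sum>i\<le>k. left_part (Suc i) (k - i)) + \<dots> = J.\<delta> (resolution_prod k)"
    by (simp add: resolution_prod_def coboundary_bidegree_part sum.distrib)
  finally show "J.\<delta> (resolution_prod k) = J.R (Suc k) (resolution_prod (Suc k))" ..
qed

lemma dvd_bidegree_part:
  assumes "(\<forall>xs. c dvd f i xs) \<or> (\<forall>ys. c dvd g j ys)"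
  shows "c dvd bidegree_part i j zs"
proof -
  have "c dvd (K.T ^^ y) (f i) xs" if "\<forall>xs. c dvd f i xs" for y xs
    using that by (simp add: K.t_op_funpow_apply[OF f_closed])
  moreover have "c dvd (L.T ^^ y) (g j) ys" if "\<forall>ys. c dvd g j ys" for y ys
    using that by (simp add: L.t_op_funpow_apply[OF g_closed])
  ultimately show ?thesis
    using assms
    by (auto simp: bidegree_part_def diagonal_def join_prod_def t_op_def pointwise sum_fun_apply
        intro!: dvd_sum intro: dvd_mult dvd_mult2)
qed

text \<open>If \<open>i + j = m + n + 1\<close>, then \<open>i > m\<close> or \<open>j > n\<close>,
  so each summand has a divisible factor.\<close>

lemma dvd_resolution_prod:
  assumes "\<And>i xs. m < i \<Longrightarrow> c dvd f i xs" "\<And>j ys. n < j \<Longrightarrow> c dvd g j ys"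
  shows "c dvd resolution_prod (Suc (m + n)) zs"
proof -
  have "c dvd bidegree_part i (Suc (m + n) - i) zs" for i
    by (rule dvd_bidegree_part, cases "m < i") (use assms in auto)
  then show ?thesis
    unfolding resolution_prod_def sum_fun_apply by (intro dvd_sum) auto
qed

end

end


section \<open>Divisible resolutions\<close>

lemma of_nat_times_fun_eq_0:
  fixes f :: "'a \<Rightarrow> int"
  shows "n > 0 \<Longrightarrow> of_nat n * f = 0 \<Longrightarrow> f = 0"
  by (auto simp: fun_eq_iff pointwise)

context zp_complex
begin

text \<open>Terms below \<open>n\<close> are kept, the term \<open>n\<close> is corrected by
  \<open>R (Suc n) x\<close>, and the continuation is \<open>p\<close> times a sequence extending
  \<open>y\<close>.\<close>

lemma divisible_resolution:
  assumes f: "aug_resolution f" and van: "vanishes_mod p f n"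
  shows "\<exists>g. aug_resolution g \<and> (\<forall>i>n. \<forall>xs. int p dvd g i xs)"
proof -
  obtain x y where x: "x \<in> F n" "n = 0 \<longrightarrow> x = 0" and y: "y \<in> F (Suc n)"
    and xy: "\<delta> (f n) = \<delta> (R (Suc n) x) + of_nat p * R (Suc n) y"
    using van by (auto simp: vanishes_mod_def)
  \<comment> \<open>Cochains have integer values, so the factor \<open>p\<close> can be cancelled;
    this makes \<open>y\<close> extendable.\<close>
  have "of_nat p * \<delta> (R (Suc n) y) = \<delta> (\<delta> (f n))"
    unfolding xy by simp
  then have "\<delta> (R (Suc n) y) = 0"
    using of_nat_times_fun_eq_0[OF p_pos] by simp
  then obtain h where h: "h (Suc n) = y"
      "\<And>j. j \<ge> Suc n \<Longrightarrow> h j \<in> F j \<and> \<delta> (h j) = R (Suc j) (h (Suc j))"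
    using extend_resolution[OF y] by auto
  define g where "g = (\<lambda>i. if i < n then f i
    else if i = n then f n - R (Suc n) x else of_nat p * h i)"
  have "g i \<in> F i" for i
    using f h x by (auto simp: g_def aug_resolution_def not_less
        intro!: aug_cochains_diff aug_cochains_scale res_op_closed)
  moreover have "g 0 = aug_unit"
    using f x by (auto simp: g_def aug_resolution_def)
  moreover have "\<delta> (g i) = R (Suc i) (g (Suc i))" for i
  proof -
    consider "Suc i < n" | "Suc i = n" | "i = n" | "i > n" by linarith
    then show ?thesis
    proof cases
      case 2
      \<comment> \<open>Subtracting \<open>R (Suc n) x\<close> does not disturb the relation one
        index earlier, since \<open>d\<close> and \<open>s\<close> annihilate each other.\<close>
      have "R n (R (Suc n) x) = R (Suc (Suc n)) (R (Suc n) x)"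
        by (simp only: res_op_Suc_Suc)
      then have "R n (R (Suc n) x) = 0"
        using res_op_res_op[OF x(1)] by simp
      then show ?thesis
        using 2 f by (auto simp: g_def aug_resolution_def)
    next
      case 3
      then show ?thesis using xy h(1) by (simp add: g_def)
    next
      case 4
      then show ?thesis using h(2)[of i] by (simp add: g_def)
    qed (use f in \<open>auto simp: g_def aug_resolution_def\<close>)
  qed
  ultimately have "aug_resolution g"
    by (simp add: aug_resolution_def)
  moreover have "int p dvd g i xs" if "i > n" for i xs
    using that by (simp add: g_def pointwise)
  ultimately show ?thesis by blast
qed

text \<open>
  If \<open>f (n + 1) = p y\<close>, write \<open>p = s + d q\<close> in the group ring. Either \<open>\<delta>sy = 0\<close> or
  \<open>\<delta>dqy = 0\<close>, according to the parity of \<open>n\<close>, so the next Smith class vanishes integrally.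
\<close>

lemma divisible_vanishes:
  assumes f: "aug_resolution f" and div: "\<And>xs. int p dvd f (Suc n) xs"
  shows "vanishes_mod p f n" and "vanishes_mod 0 f (Suc n)"
proof -
  have "f (Suc n) \<in> F (Suc n)"
    using f by (simp add: aug_resolution_def)
  then obtain y where y: "y \<in> F (Suc n)" "f (Suc n) = of_nat p * y"
    using aug_cochains_divide div by metis
  have \<delta>f: "\<delta> (f n) = of_nat p * R (Suc n) y"
    using f by (simp add: aug_resolution_def y(2))
  then show "vanishes_mod p f n"
    unfolding vanishes_mod_def using y(1)
    by (intro bexI[of _ 0] bexI[of _ y]) (simp_all add: aug_cochains_zero)
  have "of_nat p * \<delta> (R (Suc n) y) = \<delta> (\<delta> (f n))"
    unfolding \<delta>f by simp
  then have \<delta>Ry: "\<delta> (R (Suc n) y) = 0"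
    using of_nat_times_fun_eq_0[OF p_pos] by simp
  \<comment> \<open>Composed with \<open>d\<close>, this is the sum of 1 - t^k over
    \<open>k < p\<close>, that is, \<open>p\<close> minus the norm.\<close>
  define q where "q = (\<lambda>y. \<Sum>k<p. \<Sum>j<k. (T ^^ j) y)"
  have "d (q y) = (\<Sum>k<p. d (\<Sum>j<k. (T ^^ j) y))"
    unfolding q_def by (rule additive.sum[OF additive_d_op])
  also have "\<dots> = of_nat p * y - s y"
    by (simp only: d_op_geometric_sum sum_subtractf) (simp add: s_op_def)
  finally have norm: "of_nat p * y = s y + d (q y)" by simp
  have q_closed: "q y \<in> F (Suc n)"
    unfolding q_def by (intro aug_cochains_sum t_op_funpow_closed y)
  have "\<exists>x\<in>F (Suc n). \<delta> (f (Suc n)) = \<delta> (R (Suc (Suc n)) x)"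
  proof (cases "even n")
    case True
    then have "\<delta> (f (Suc n)) = \<delta> (R (Suc (Suc n)) (q y))"
      using \<delta>Ry unfolding y(2) norm by (simp add: res_op_def)
    then show ?thesis using q_closed by blast
  next
    case False
    \<comment> \<open>\<open>q\<close> is a polynomial in t, so it commutes with \<open>d\<close>
      and with \<open>\<delta>\<close>.\<close>
    have "d (q y) = q (d y)"
      by (simp add: q_def d_op_def sum_subtractf funpow_swap1)
    then have "\<delta> (d (q y)) = q (\<delta> (d y))"
      by (simp add: q_def t_op_funpow_coboundary)
    also have "\<dots> = 0"
      using \<delta>Ry False by (simp add: res_op_def q_def)
    finally have "\<delta> (f (Suc n)) = \<delta> (R (Suc (Suc n)) y)"
      using False unfolding y(2) norm by (simp add: res_op_def)
    then show ?thesis using y(1) by blast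
  qed
  then show "vanishes_mod 0 f (Suc n)"
    unfolding vanishes_mod_def using aug_cochains_zero[of K "Suc (Suc n)"] by auto
qed

end

text \<open>Divisibility of the product term of index \<open>m + n + 1\<close>, which sits in
  dimension \<open>m + n\<close>, is the input of both parts of
  \<open>divisible_vanishes\<close>.\<close>

lemma (in zp_join) join_smith_class_zero:
  assumes "smith_class_zero_mod p p K t m" and "smith_class_zero_mod p p L u n"
  shows "smith_class_zero_mod p p (simplicial_join K L) (map_sum t u) (m + n)"
    and "smith_class_zero p (simplicial_join K L) (map_sum t u) (Suc (m + n))"
proof -
  obtain f0 g0 where "K.aug_resolution f0" "L.aug_resolution g0"
    using K.ex_aug_resolution L.ex_aug_resolution by blast
  then obtain f g where f: "K.aug_resolution f" "\<forall>i>m. \<forall>xs. int p dvd f i xs"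
    and g: "L.aug_resolution g" "\<forall>j>n. \<forall>ys. int p dvd g j ys"
    using assms K.divisible_resolution L.divisible_resolution
      K.smith_class_zero_mod_iff L.smith_class_zero_mod_iff by metis
  have res: "J.aug_resolution (resolution_prod f g)"
    by (rule aug_resolution_prod[OF f(1) g(1)])
  have div: "int p dvd resolution_prod f g (Suc (m + n)) zs" for zs
    using f g by (intro dvd_resolution_prod) auto
  show "smith_class_zero_mod p p (simplicial_join K L) (map_sum t u) (m + n)"
    using J.divisible_vanishes(1)[OF res div] J.smith_class_zero_mod_iff[OF res] by blast
  show "smith_class_zero p (simplicial_join K L) (map_sum t u) (Suc (m + n))"
    using J.divisible_vanishes(2)[OF res div] by (rule J.smith_class_zeroI[OF res])
qed

theorem theorem5:
  fixes p :: nat and K :: "'a set set" and L :: "'b set set"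
    and t :: "'a \<Rightarrow> 'a" and u :: "'b \<Rightarrow> 'b"
  assumes "prime p"
    and "Zp_complex p K t" and "Zp_complex p L u"
    and "int (smith_index_mod p K t) = int (smith_index p K t) - 1"
    and "int (smith_index_mod p L u) = int (smith_index p L u) - 1"
  shows "int (smith_index p (simplicial_join K L) (map_sum t u))
           \<le> int (smith_index p K t) + int (smith_index p L u) - 1 \<and>
         smith_class_zero_mod p p (simplicial_join K L) (map_sum t u)
           (smith_index p K t + smith_index p L u - 2)"
proof -
  have "p > 0" using \<open>prime p\<close> by (rule prime_gt_0_nat)
  then interpret zp_join p K t L u
    by unfold_locales (use assms in auto)
  define m where "m = smith_index_mod p K t"
  define n where "n = smith_index_mod p L u"
  have "smith_class_zero_mod p p K t m" "smith_class_zero_mod p p L u n"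
    unfolding m_def n_def smith_index_mod_def
    using K.ex_smith_class_zero_mod L.ex_smith_class_zero_mod by (auto intro: LeastI_ex)
  note join = join_smith_class_zero[OF this]
  \<comment> \<open>The hypotheses are equations between integers, so both indices are positive and
    the truncated subtraction of 2 yields \<open>m + n\<close>.\<close>
  have "smith_index p K t = Suc m" "smith_index p L u = Suc n"
    using assms(4,5) by (auto simp: m_def n_def)
  moreover have "smith_index p (simplicial_join K L) (map_sum t u) \<le> Suc (m + n)"
    unfolding smith_index_def using join(2) by (rule Least_le)
  ultimately show ?thesis using join(1) by simp
qed

end
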